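(* Let $m,n,k$ be positive integers and let $\tau=1^m\text{-}1^m\text{-}\cdots\text{-}1^m$ consist of $n$ runs of $m$ ones separated by $n-1$ dashes. Let $A$ be the set of $k$-ary words (including the empty word) that cyclically avoid $\tau$, and for a word $s_1\cdots s_l$ let $w(s_1\cdots s_l)=x_{s_1}\cdots x_{s_l}$. Then \[ \sum_{W\in A}w(W)=1+\sum_{i=1}^k\Phi\left(t^{-1}\cdot T\left\{u\frac{\partial^2}{\partial v\,\partial u}\bigg|_{v=1}H(x_i,u,v)\right\}\left(-1+\prod_{\substack{j=1\\ j\ne i}}^k T\{H(x_j,u,1)\}\right)\right)+\sum_{i=1}^k\frac{x_i-x_i^{mn}}{1-x_i}. \] In particular, setting $x_i=x$ for all $i$, \[ \sum_{W\in A}x^{\mathrm{len}(W)}=1+k\,\Phi\left(t^{-1}\cdot T\left\{u\frac{\partial^2}{\partial v\,\partial u}\bigg|_{v=1}H(x,u,v)\right\}\left(\big(T\{H(x,u,1)\}\big)^{k-1}-1\right)\right)+\frac{k(x-x^{mn})}{1-x}. \]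
   Context: A word $W=s_1\cdots s_l$ contains $\tau$ if it has $nm$ equal letters at positions $i_1<\cdots<i_{nm}$ such that within each successive block of $m$ of these positions the positions are consecutive; otherwise it avoids $\tau$. With $r(a_1\cdots a_l)=a_la_1\cdots a_{l-1}$, $W$ cyclically avoids $\tau$ if $r^j(W)$ avoids $\tau$ for every $j$. $\mathrm{len}(W)$ is the number of letters. A factorization on $\{1\}$ is an ordered list $(1^{c_1})\cdots(1^{c_p})$ of nonempty words, with $\mathrm{parts}=p$, $\mathrm{len}=c_1+\cdots+c_p$, $\mathrm{fst}=c_1$ ($\mathrm{fst}(\emptyset)=0$). It contains $\tau$ if the word obtained by inserting a letter $0$ between adjacent parts contains $\tau$ via an occurrence not using $0$ (equivalently, there are $n$ disjoint runs of $m$ consecutive ones each inside a single part). $H(x,u,v)=\sum_\phi x^{\mathrm{len}(\phi)}u^{\mathrm{parts}(\phi)}v^{\mathrm{fst}(\phi)}$, summed over all factorizations on $\{1\}$ (including the empty one) avoiding $\tau$. The polynomials $l_p(t)$ are defined by $\sum_{p\ge0}l_p(t)y^p=e^{ty/(1+y)}$ (so $l_p(t)=(-1)^pL_p^{(-1)}(t)$). $T$ is the linear map $u^p\mapsto l_p(t)$, applied coefficientwise to power series in $u$ with coefficients power series in the $x$-variables. $\Phi$ is the linear map $t^j\mapsto j!$ fixing other variables, applied coefficientwise; $t^{-1}$ times a series all of whose coefficients are polynomials in $t$ divisible by $t$ means dividing each coefficient by $t$. *)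

theory Defs
  imports "HOL-Computational_Algebra.Computational_Algebra"
begin

definition occ_letter :: "nat \<Rightarrow> nat \<Rightarrow> nat list \<Rightarrow> nat \<Rightarrow> bool" where
  "occ_letter n m W a \<longleftrightarrow>
     (\<exists>f :: nat \<Rightarrow> nat.
        (\<forall>q < n * m. f q < length W \<and> W ! (f q) = a) \<and>
        (\<forall>q. Suc q < n * m \<longrightarrow> f q < f (Suc q)) \<and>
        (\<forall>b < n. \<forall>r. Suc r < m \<longrightarrow> f (b * m + Suc r) = Suc (f (b * m + r))))"

definition contains_tau :: "nat \<Rightarrow> nat \<Rightarrow> nat list \<Rightarrow> bool" where
  "contains_tau n m W \<longleftrightarrow> (\<exists>a. occ_letter n m W a)"

definition rot :: "'a list \<Rightarrow> 'a list" where
  "rot W = (if W = [] then [] else last W # butlast W)"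

definition cyc_avoids :: "nat \<Rightarrow> nat \<Rightarrow> nat list \<Rightarrow> bool" where
  "cyc_avoids n m W \<longleftrightarrow> (\<forall>j. \<not> contains_tau n m ((rot ^^ j) W))"

definition cycA :: "nat \<Rightarrow> nat \<Rightarrow> nat \<Rightarrow> nat list set" where
  "cycA n m k = {W. set W \<subseteq> {1..k} \<and> cyc_avoids n m W}"

text \<open>A factorization (1^c_1)...(1^c_p) is the list [c_1,...,c_p] of positive
  integers.  sepword inserts the letter 0 between adjacent parts.\<close>
fun sepword :: "nat list \<Rightarrow> nat list" where
  "sepword [] = []"
| "sepword [c] = replicate c 1"
| "sepword (c # d # cs) = replicate c 1 @ 0 # sepword (d # cs)"

text \<open>Contains tau via an occurrence not using 0 (all letters of an occurrence
  are equal, and the only other letter is 1).\<close>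
definition fact_contains :: "nat \<Rightarrow> nat \<Rightarrow> nat list \<Rightarrow> bool" where
  "fact_contains n m cs \<longleftrightarrow> occ_letter n m (sepword cs) 1"

definition fst_part :: "nat list \<Rightarrow> nat" where
  "fst_part cs = (case cs of [] \<Rightarrow> 0 | c # _ \<Rightarrow> c)"

text \<open>Number of tau-avoiding factorizations with len c, parts p, fst f,
  i.e. the coefficient of x^c u^p v^f in H(x,u,v).\<close>
definition hcnt :: "nat \<Rightarrow> nat \<Rightarrow> nat \<Rightarrow> nat \<Rightarrow> nat \<Rightarrow> nat" where
  "hcnt n m c p f = card {cs. (\<forall>x \<in> set cs. 0 < x) \<and> sum_list cs = c \<and> length cs = p
                             \<and> fst_part cs = f \<and> \<not> fact_contains n m cs}"

text \<open>l_p(t): sum_p l_p(t) y^p = e^{ty/(1+y)} = sum_j t^j/j! (y/(1+y))^j, so the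
  coefficient of t^j in l_p(t) is [y^p] (y/(1+y))^j / j!.\<close>
definition lpoly :: "nat \<Rightarrow> real poly" where
  "lpoly p = (\<Sum>j \<in> {j. fps_nth ((fps_X / (1 + fps_X)) ^ j :: real fps) p \<noteq> 0}.
                 smult (fps_nth ((fps_X / (1 + fps_X)) ^ j :: real fps) p / fact j) (monom 1 j))"

text \<open>T on a polynomial in u given by its coefficients a p: u^p \<mapsto> l_p(t).\<close>
definition Tmap :: "(nat \<Rightarrow> real) \<Rightarrow> real poly" where
  "Tmap a = (\<Sum>p \<in> {p. a p \<noteq> 0}. smult (a p) (lpoly p))"

definition Phi :: "real poly \<Rightarrow> real" where
  "Phi q = (\<Sum>j \<le> degree q. coeff q j * fact j)"

text \<open>t^{-1} times a polynomial divisible by t.\<close>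
definition tinv :: "real poly \<Rightarrow> real poly" where
  "tinv q = q div [:0, 1:]"

text \<open>T{ u d^2/(dv du)|_{v=1} H(x,u,v) } as a power series in x with coefficients
  in R[t]: the coefficient of x^c u^p in u d^2/(dv du)|_{v=1} H is
  p * sum_f f * hcnt c p f.\<close>
definition TD :: "nat \<Rightarrow> nat \<Rightarrow> real poly fps" where
  "TD n m = Abs_fps (\<lambda>c. Tmap (\<lambda>p. of_nat p *
       (\<Sum>f \<in> {f. hcnt n m c p f \<noteq> 0}. of_nat f * of_nat (hcnt n m c p f))))"

text \<open>T{ H(x,u,1) }: the coefficient of x^c u^p in H(x,u,1) is sum_f hcnt c p f.\<close>
definition TH :: "nat \<Rightarrow> nat \<Rightarrow> real poly fps" where
  "TH n m = Abs_fps (\<lambda>c. Tmap (\<lambda>p.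
       (\<Sum>f \<in> {f. hcnt n m c p f \<noteq> 0}. of_nat (hcnt n m c p f))))"

definition geomser :: "nat \<Rightarrow> nat \<Rightarrow> real fps" where
  "geomser n m = (fps_X - fps_X ^ (m * n)) / (1 - fps_X)"

section \<open>Power series in x_1, x_2, ... (coefficient functions on exponent vectors)\<close>

type_synonym 'a mser = "(nat \<Rightarrow> nat) \<Rightarrow> 'a"

definition mone :: "'a::comm_ring_1 mser" where
  "mone \<alpha> = (if \<forall>j. \<alpha> j = 0 then 1 else 0)"

definition mmult :: "'a::comm_ring_1 mser \<Rightarrow> 'a mser \<Rightarrow> 'a mser" where
  "mmult F G \<alpha> = (\<Sum>\<beta> \<in> {\<beta>. \<forall>j. \<beta> j \<le> \<alpha> j}. F \<beta> * G (\<lambda>j. \<alpha> j - \<beta> j))"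

definition mminus :: "'a::comm_ring_1 mser \<Rightarrow> 'a mser \<Rightarrow> 'a mser" where
  "mminus F G \<alpha> = F \<alpha> - G \<alpha>"

definition memb :: "nat \<Rightarrow> 'a::comm_ring_1 fps \<Rightarrow> 'a mser" where
  "memb i F \<alpha> = (if \<forall>j. j \<noteq> i \<longrightarrow> \<alpha> j = 0 then fps_nth F (\<alpha> i) else 0)"

definition mprod_list :: "'a::comm_ring_1 mser list \<Rightarrow> 'a mser" where
  "mprod_list Fs = foldr mmult Fs mone"

definition genA :: "nat \<Rightarrow> nat \<Rightarrow> nat \<Rightarrow> real mser" where
  "genA n m k \<alpha> = of_nat (card {W \<in> cycA n m k. \<forall>j. count_list W j = \<alpha> j})"

definition rhsA :: "nat \<Rightarrow> nat \<Rightarrow> nat \<Rightarrow> real mser" where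
  "rhsA n m k \<alpha> =
     mone \<alpha>
     + (\<Sum>i = 1..k. Phi (tinv (mmult (memb i (TD n m))
            (mminus (mprod_list (map (\<lambda>j. memb j (TH n m)) (filter (\<lambda>j. j \<noteq> i) [1..<k+1])))
                    mone) \<alpha>)))
     + (\<Sum>i = 1..k. memb i (geomser n m) \<alpha>)"

end

theory Submission
  imports Defs
begin

text \<open>
  A cyclically avoiding word that is not constant can be rotated so that no run wraps around; then it
  avoids \<open>\<tau>\<close> cyclically iff for each letter \<open>j\<close> the factorization \<open>\<phi>\<^sub>j\<close> formed by the runs
  of \<open>j\<close> avoids \<open>\<tau>\<close>. If the word begins with \<open>i\<close>, the possible rotations are counted by the first
  part of \<open>\<phi>\<^sub>i\<close>, which accounts for the derivative in \<open>v\<close>. Given the \<open>\<phi>\<^sub>j\<close>, with \<open>p\<^sub>j\<close> parts,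
  it remains to count the interleavings in which no two (cyclically) adjacent parts belong to the same letter.

  Let \<open>C\<close> be the number of linear interleavings and \<open>C\<^sub>i\<close> the number of those beginning with the letter \<open>i\<close>.
  Then \<open>C\<^sub>i(p) + C\<^sub>i(p - e\<^sub>i) = C(p - e\<^sub>i)\<close>, and \<open>C\<close> is the sum of the \<open>C\<^sub>i\<close> unless \<open>p = 0\<close>. Because of
  \<open>l\<^sub>p\<^sub>+\<^sub>1' + l\<^sub>p' = l\<^sub>p\<close> and \<open>\<Phi>(q') = \<Phi>(q) - q(0)\<close>, the same recurrences are satisfied by \<open>\<Phi>\<close> of the
  product of the \<open>l\<^bsub>p\<^sub>j\<^esub>\<close>, and of that product with the factor of \<open>i\<close> differentiated. In the same way
  \<open>(p + 1) l\<^sub>p\<^sub>+\<^sub>1 + p l\<^sub>p = t l\<^sub>p\<^sub>+\<^sub>1'\<close> yields the interleavings that begin but do not end with \<open>i\<close>, whence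
  the operators \<open>t\<^sup>-\<^sup>1\<close> and \<open>u \<partial>/\<partial>u\<close>.
\<close>

section \<open>Occurrences of the pattern and runs\<close>

lemma occ_letter_0 [simp]: "occ_letter 0 m W a"
  by (simp add: occ_letter_def)

text \<open>The first block occupies positions \<open>f 0\<close> to \<open>f 0 + m - 1\<close>, and
  all later ones lie behind it. Splitting it off replaces index functions by a recursion on
  \<open>n\<close>, which is all that is used from here on.\<close>

lemma occ_letter_Suc:
  assumes m: "0 < m"
  shows "occ_letter (Suc n) m W a \<longleftrightarrow> (\<exists>U V. W = U @ replicate m a @ V \<and> occ_letter n m V a)"
proof
  assume "occ_letter (Suc n) m W a"
  then obtain f where f1: "\<And>q. q < Suc n * m \<Longrightarrow> f q < length W \<and> W ! f q = a"
    and f2: "\<And>q. Suc q < Suc n * m \<Longrightarrow> f q < f (Suc q)"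
    and f3: "\<And>b r. b < Suc n \<Longrightarrow> Suc r < m \<Longrightarrow> f (b * m + Suc r) = Suc (f (b * m + r))"
    unfolding occ_letter_def by blast
  have f0: "f r = f 0 + r" if "r < m" for r
    using that
  proof (induction r)
    case (Suc r) then show ?case using f3[of 0 r] by simp
  qed simp
  have ge: "f 0 + m \<le> f (q + m)" if "q + m < Suc n * m" for q
    using that
  proof (induction q)
    case 0
    have "f (m - 1) < f (Suc (m - 1))" using 0 m by (intro f2) auto
    then show ?case using f0[of "m-1"] m by simp
  next
    case (Suc q) then show ?case using f2[of "q + m"] by simp
  qed
  have len: "f 0 + m \<le> length W"
  proof -
    have "f (m - 1) < length W" using f1[of "m - 1"] m by (simp add: trans_less_add1)
    then show ?thesis using f0[of "m - 1"] m by simp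
  qed
  have "take m (drop (f 0) W) = replicate m a"
  proof (rule nth_equalityI)
    fix i assume "i < length (take m (drop (f 0) W))"
    then have "i < m" using len by simp
    then show "take m (drop (f 0) W) ! i = replicate m a ! i"
      using f1[of i] f0[of i] len by simp
  qed (use len in simp)
  then have "W = take (f 0) W @ replicate m a @ drop (f 0 + m) W"
    by (metis add.commute append_take_drop_id drop_drop)
  moreover have "occ_letter n m (drop (f 0 + m) W) a"
    unfolding occ_letter_def
  proof (intro exI[of _ "\<lambda>q. f (q + m) - (f 0 + m)"] conjI allI impI)
    fix q assume q: "q < n * m"
    show "f (q + m) - (f 0 + m) < length (drop (f 0 + m) W)"
      using ge[of q] f1[of "q + m"] q len by (simp add: diff_less_mono)
    show "drop (f 0 + m) W ! (f (q + m) - (f 0 + m)) = a"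
      using ge[of q] f1[of "q + m"] q len by simp
  next
    fix q assume "Suc q < n * m"
    then show "f (q + m) - (f 0 + m) < f (Suc q + m) - (f 0 + m)"
      using ge[of q] f2[of "q + m"] by simp
  next
    fix b r assume b: "b < n" and r: "Suc r < m"
    have "b * m + m \<le> n * m" using b mult_le_mono1[of "Suc b" n m] by simp
    then show "f (b * m + Suc r + m) - (f 0 + m) = Suc (f (b * m + r + m) - (f 0 + m))"
      using f3[of "Suc b" r] b r ge[of "b * m + r"] by (simp add: add_ac)
  qed
  ultimately show "\<exists>U V. W = U @ replicate m a @ V \<and> occ_letter n m V a" by blast
next
  assume "\<exists>U V. W = U @ replicate m a @ V \<and> occ_letter n m V a"
  then obtain U V f where W: "W = U @ replicate m a @ V"
    and f1: "\<And>q. q < n * m \<Longrightarrow> f q < length V \<and> V ! f q = a"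
    and f2: "\<And>q. Suc q < n * m \<Longrightarrow> f q < f (Suc q)"
    and f3: "\<And>b r. b < n \<Longrightarrow> Suc r < m \<Longrightarrow> f (b * m + Suc r) = Suc (f (b * m + r))"
    unfolding occ_letter_def by blast
  define h where "h q = (if q < m then length U + q else length U + m + f (q - m))" for q
  show "occ_letter (Suc n) m W a"
    unfolding occ_letter_def
  proof (intro exI[of _ h] conjI allI impI)
    fix q assume q: "q < Suc n * m"
    show "h q < length W" using f1[of "q - m"] q by (auto simp: h_def W)
    show "W ! h q = a" using f1[of "q - m"] q by (auto simp: h_def W nth_append)
  next
    fix q assume q: "Suc q < Suc n * m"
    show "h q < h (Suc q)"
      using f2[of "q - m"] q by (auto simp: h_def Suc_diff_le)
  next
    fix b r assume b: "b < Suc n" and r: "Suc r < m"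
    show "h (b * m + Suc r) = Suc (h (b * m + r))"
    proof (cases b)
      case 0 then show ?thesis using r by (simp add: h_def)
    next
      case (Suc b')
      then show ?thesis using f3[of b' r] b r by (simp add: h_def)
    qed
  qed
qed

lemma occ_letter_prepend: "0 < m \<Longrightarrow> occ_letter n m W a \<Longrightarrow> occ_letter n m (U @ W) a"
  by (cases n) (auto simp: occ_letter_Suc, metis append.assoc)

text \<open>Greedy choice: the first block of any occurrence ends no earlier than the leading
  \<open>m\<close> letters do, so the other blocks already lie in \<open>W\<close>.\<close>

lemma occ_letter_Suc_replicate:
  assumes m: "0 < m"
  shows "occ_letter (Suc n) m (replicate m a @ W) a \<longleftrightarrow> occ_letter n m W a"
proof
  assume "occ_letter (Suc n) m (replicate m a @ W) a"
  then obtain U V where e: "replicate m a @ W = U @ replicate m a @ V" and o: "occ_letter n m V a"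
    by (auto simp: occ_letter_Suc m)
  have "length (replicate m a) \<le> length (U @ replicate m a)" by simp
  then obtain Z where "W = Z @ V"
    using e append_eq_append_conv_if[of "replicate m a" W "U @ replicate m a" V]
    by (metis append.assoc)
  then show "occ_letter n m W a" using o m by (simp add: occ_letter_prepend)
next
  assume "occ_letter n m W a"
  then show "occ_letter (Suc n) m (replicate m a @ W) a"
    unfolding occ_letter_Suc[OF m] by (intro exI[of _ "[]"] exI[of _ W]) simp
qed

lemma occ_letter_Cons_neq:
  assumes m: "0 < m" and "x \<noteq> a"
  shows "occ_letter n m (x # W) a \<longleftrightarrow> occ_letter n m W a"
proof (cases n)
  case (Suc n')
  have "x # W = U @ replicate m a @ V \<longleftrightarrow> (\<exists>U'. U = x # U' \<and> W = U' @ replicate m a @ V)" for U V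
    using assms by (cases U; cases m) auto
  then show ?thesis using m by (auto simp: Suc occ_letter_Suc)
qed simp

lemma occ_letter_replicate_neq:
  "0 < m \<Longrightarrow> b \<noteq> a \<Longrightarrow> occ_letter n m (replicate c b @ W) a \<longleftrightarrow> occ_letter n m W a"
  by (induction c) (auto simp: occ_letter_Cons_neq)

text \<open>A maximal run shorter than \<open>m\<close> cannot hold a block, and a block cannot
  continue past the run.\<close>

lemma occ_letter_replicate_less:
  assumes m: "0 < m" and c: "c < m" and W: "W = [] \<or> hd W \<noteq> a"
  shows "occ_letter n m (replicate c a @ W) a \<longleftrightarrow> occ_letter n m W a"
proof (cases n)
  case (Suc n')
  have "\<exists>U'. W = U' @ replicate m a @ V"
    if e: "replicate c a @ W = U @ replicate m a @ V" for U V
  proof (cases "c \<le> length U")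
    case True
    then show ?thesis using e append_eq_append_conv_if[of "replicate c a" W U "replicate m a @ V"]
      by auto
  next
    \<comment> \<open>The block starts inside the run, hence covers position \<open>c\<close>, which
      holds the first letter of \<open>W\<close>.\<close>
    case False
    have "length (replicate c a @ W) \<ge> length U + m" using e by simp
    then have "W \<noteq> []" using False c by auto
    moreover have "(replicate c a @ W) ! c = a"
      using False c by (simp add: e nth_append less_diff_conv2)
    ultimately show ?thesis using W by (simp add: nth_append hd_conv_nth)
  qed
  then have "occ_letter n m (replicate c a @ W) a \<Longrightarrow> occ_letter n m W a"
    using m by (simp add: Suc occ_letter_Suc) metis
  then show ?thesis using m occ_letter_prepend by blast
qed simp

text \<open>Blocks are peeled off the run until fewer than \<open>m\<close> letters remain. The
  truncated subtraction covers the case that the run alone supplies all \<open>n\<close>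
  blocks.\<close>

lemma occ_letter_replicate:
  assumes m: "0 < m" and W: "W = [] \<or> hd W \<noteq> a"
  shows "occ_letter n m (replicate c a @ W) a \<longleftrightarrow> occ_letter (n - c div m) m W a"
proof (induction c arbitrary: n rule: less_induct)
  case (less c)
  show ?case
  proof (cases "c < m \<or> n = 0")
    case True
    then show ?thesis using occ_letter_replicate_less[OF m _ W] by auto
  next
    case False
    then obtain n' where n: "n = Suc n'" by (cases n) auto
    have "replicate c a = replicate m a @ replicate (c - m) a"
      using False by (simp flip: replicate_add)
    then have "occ_letter n m (replicate c a @ W) a \<longleftrightarrow> occ_letter n' m (replicate (c - m) a @ W) a"
      by (simp add: n occ_letter_Suc_replicate m)
    also have "\<dots> \<longleftrightarrow> occ_letter (n' - (c - m) div m) m W a"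
      using less False m by simp
    also have "n' - (c - m) div m = n - c div m"
      using False m by (simp add: n le_div_geq)
    finally show ?thesis .
  qed
qed

lemma occ_letter_append:
  assumes m: "0 < m"
  shows "occ_letter n1 m X a \<Longrightarrow> occ_letter n2 m Y a \<Longrightarrow> occ_letter (n1 + n2) m (X @ Y) a"
proof (induction n1 arbitrary: X)
  case 0 then show ?case using m by (simp add: occ_letter_prepend)
next
  case (Suc n1)
  then obtain U V where "X = U @ replicate m a @ V" "occ_letter n1 m V a"
    using m by (auto simp: occ_letter_Suc)
  then show ?case using Suc.IH[of V] Suc.prems(2) m by (auto simp: occ_letter_Suc)
qed

section \<open>Run-length encoding of words\<close>

definition expand :: "('a \<times> nat) list \<Rightarrow> 'a list" where
  "expand rl = concat (map (\<lambda>(a, c). replicate c a) rl)"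

text \<open>This is the factorization that the word induces on the letter \<open>a\<close>.\<close>

definition blocks :: "'a \<Rightarrow> ('a \<times> nat) list \<Rightarrow> nat list" where
  "blocks a rl = map snd (filter (\<lambda>b. fst b = a) rl)"

text \<open>The two conditions make the runs maximal, so every word has exactly one such encoding
  (\<open>expand_surj\<close>, \<open>expand_inj\<close>).\<close>

definition runlist :: "('a \<times> nat) list \<Rightarrow> bool" where
  "runlist rl \<longleftrightarrow> distinct_adj (map fst rl) \<and> (\<forall>b \<in> set rl. 0 < snd b)"

lemma expand_simps [simp]:
  "expand [] = []" "expand ((a, c) # rl) = replicate c a @ expand rl"
  "expand (rl @ rl') = expand rl @ expand rl'"
  by (auto simp: expand_def)

lemma blocks_simps [simp]:
  "blocks a [] = []"
  "blocks a ((b, c) # rl) = (if a = b then c # blocks a rl else blocks a rl)"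
  "blocks a (rl @ rl') = blocks a rl @ blocks a rl'"
  "blocks a (rev rl) = rev (blocks a rl)"
  by (auto simp: blocks_def rev_map rev_filter)

lemma runlist_Nil [simp]: "runlist []"
  by (simp add: runlist_def)

lemma runlist_Cons:
  "runlist ((a, c) # rl) \<longleftrightarrow> 0 < c \<and> runlist rl \<and> (rl = [] \<or> fst (hd rl) \<noteq> a)"
  by (cases rl) (auto simp: runlist_def)

lemma runlist_append:
  "runlist (rl @ rl') \<longleftrightarrow> runlist rl \<and> runlist rl' \<and>
     (rl = [] \<or> rl' = [] \<or> fst (last rl) \<noteq> fst (hd rl'))"
  by (auto simp: runlist_def distinct_adj_append_iff last_map hd_map)

lemma expand_eq_Nil_iff: "runlist rl \<Longrightarrow> expand rl = [] \<longleftrightarrow> rl = []"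
  by (cases rl) (auto simp: runlist_def)

lemma hd_expand: "runlist rl \<Longrightarrow> rl \<noteq> [] \<Longrightarrow> hd (expand rl) = fst (hd rl)"
  by (cases rl) (auto simp: runlist_def)

lemma last_expand: "runlist rl \<Longrightarrow> rl \<noteq> [] \<Longrightarrow> last (expand rl) = fst (last rl)"
  by (cases rl rule: rev_cases) (auto simp: runlist_append runlist_Cons)

lemma count_list_expand: "count_list (expand rl) a = sum_list (blocks a rl)"
proof -
  have "count_list (replicate c b) a = (if a = b then c else 0)" for c and b :: 'a
    by (induction c) auto
  then show ?thesis by (induction rl) auto
qed

lemma set_expand: "runlist rl \<Longrightarrow> set (expand rl) = fst ` set rl"
  by (force simp: expand_def runlist_def)

lemma expand_surj: "\<exists>rl. runlist rl \<and> expand rl = W"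
proof (induction W)
  case Nil show ?case by (intro exI[of _ "[]"]) simp
next
  case (Cons x W)
  then obtain rl where rl: "runlist rl" "expand rl = W" by blast
  show ?case
  proof (cases "rl \<noteq> [] \<and> fst (hd rl) = x")
    case True
    then obtain c r where "rl = (x, c) # r" by (cases rl) auto
    then show ?thesis using rl by (intro exI[of _ "(x, Suc c) # r"]) (auto simp: runlist_Cons)
  next
    case False
    then have "runlist ((x, 1) # rl)" using rl(1) by (auto simp: runlist_Cons)
    then show ?thesis using rl(2) by (intro exI[of _ "(x, 1) # rl"]) simp
  qed
qed

text \<open>The next run starts with another letter, so the length of the first run can be read off
  the word.\<close>

lemma takeWhile_expand:
  assumes "runlist ((a, c) # rl)"
  shows "takeWhile (\<lambda>x. x = a) (expand ((a, c) # rl)) = replicate c a"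
proof -
  have "takeWhile (\<lambda>x. x = a) (expand rl) = []"
  proof (cases "rl = []")
    case False
    then have "expand rl \<noteq> []" "hd (expand rl) \<noteq> a"
      using assms by (auto simp: runlist_Cons expand_eq_Nil_iff hd_expand)
    then show ?thesis by (cases "expand rl") auto
  qed simp
  then show ?thesis by (simp add: takeWhile_append)
qed

lemma expand_inj: "inj_on expand {rl. runlist rl}"
proof -
  have "rl = rl'" if "runlist rl" "runlist rl'" "expand rl = expand rl'" for rl rl' :: "('a \<times> nat) list"
    using that
  proof (induction rl arbitrary: rl')
    case Nil
    then show ?case by (metis expand_eq_Nil_iff expand_simps(1))
  next
    case (Cons b rl)
    obtain a c where b: "b = (a, c)" by (cases b)
    from Cons.prems have "rl' \<noteq> []"
      by (metis expand_eq_Nil_iff expand_simps(1) list.distinct(1))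
    then obtain a' c' r' where rl': "rl' = (a', c') # r'" by (cases rl') auto
    have a: "a' = a"
      using Cons.prems hd_expand[of rl'] hd_expand[of "b # rl"] by (simp add: b rl')
    have "c' = c"
      using Cons.prems takeWhile_expand[of a c rl] takeWhile_expand[of a c' r']
      by (metis a b length_replicate rl')
    then show ?case using Cons a b rl' by (auto simp: runlist_Cons)
  qed
  then show ?thesis by (auto simp: inj_on_def)
qed

text \<open>No block straddles two maximal runs, and a run of length \<open>c\<close> holds
  \<open>c div m\<close> disjoint blocks. Containment thus becomes a numerical condition on the
  factorization of \<open>a\<close> alone.\<close>

lemma occ_letter_expand:
  assumes m: "0 < m"
  shows "runlist rl \<Longrightarrow> occ_letter n m (expand rl) a \<longleftrightarrow> n \<le> (\<Sum>c \<leftarrow> blocks a rl. c div m)"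
proof (induction rl arbitrary: n)
  case Nil
  show ?case using m by (cases n) (auto simp: occ_letter_Suc)
next
  case (Cons b rl)
  obtain x c where b: "b = (x, c)" by (cases b)
  have rl: "runlist rl" "rl = [] \<or> fst (hd rl) \<noteq> x" using Cons.prems by (auto simp: b runlist_Cons)
  then have "expand rl = [] \<or> hd (expand rl) \<noteq> x" by (cases "rl = []") (auto simp: hd_expand)
  then show ?case
    using Cons.IH[OF rl(1)] m occ_letter_replicate[OF m, of "expand rl" a n c]
      occ_letter_replicate_neq[OF m, of x a n c "expand rl"]
    by (cases "a = x") (simp_all add: b le_diff_conv add.commute)
qed

lemma fact_contains_iff:
  assumes m: "0 < m" and "\<forall>x \<in> set cs. 0 < x"
  shows "fact_contains n m cs \<longleftrightarrow> n \<le> (\<Sum>c \<leftarrow> cs. c div m)"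
proof -
  \<comment> \<open>The separating zeros are runs of length 1, so \<open>sepword cs\<close> has a
    run-length encoding to which the same count applies. That it starts with a run of ones is
    carried along so that a zero can be put in front.\<close>
  have "\<exists>rl. runlist rl \<and> expand rl = sepword cs \<and> blocks 1 rl = cs \<and> (cs \<noteq> [] \<longrightarrow> rl \<noteq> [] \<and> fst (hd rl) = 1)"
    using assms(2)
  proof (induction cs rule: sepword.induct)
    case 1 show ?case by (intro exI[of _ "[]"]) simp
  next
    case (2 c) then show ?case by (intro exI[of _ "[(1, c)]"]) (simp add: runlist_Cons)
  next
    case (3 c d cs)
    then obtain rl where "runlist rl" "expand rl = sepword (d # cs)" "blocks 1 rl = d # cs" "rl \<noteq> []" "fst (hd rl) = 1"
      by auto
    then show ?case using 3
      by (intro exI[of _ "(1, c) # (0, 1) # rl"]) (simp add: runlist_Cons)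
  qed
  then show ?thesis unfolding fact_contains_def using occ_letter_expand[OF m] by metis
qed

text \<open>The word and its factorizations obey the same count. Letters outside \<open>K\<close>
  have no runs, and \<open>0 < n\<close> then excludes an occurrence.\<close>

lemma not_contains_tau_expand:
  assumes "0 < m" "0 < n" "runlist rl" "fst ` set rl \<subseteq> K"
  shows "\<not> contains_tau n m (expand rl) \<longleftrightarrow> (\<forall>a \<in> K. \<not> fact_contains n m (blocks a rl))"
proof -
  have pos: "\<forall>x \<in> set (blocks a rl). 0 < x" for a
    using assms(3) by (auto simp: blocks_def runlist_def)
  have "blocks a rl = []" if "a \<notin> K" for a
    using that assms(4) by (auto simp: blocks_def filter_empty_conv)
  then show ?thesis using assms
    by (auto simp: contains_tau_def occ_letter_expand fact_contains_iff[OF assms(1) pos])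
qed

section \<open>Rotations and cyclic avoidance\<close>

lemma rot_conv_rotate1: "rot W = rev (rotate1 (rev W))"
  by (cases W rule: rev_cases) (auto simp: rot_def)

lemma rot_funpow: "(rot ^^ j) W = rev (rotate j (rev W))"
proof (induction j)
  case (Suc j)
  then have "(rot ^^ Suc j) W = rot (rev (rotate j (rev W)))" by simp
  also have "\<dots> = rev (rotate (Suc j) (rev W))"
    by (simp only: rot_conv_rotate1 rev_rev_ident rotate_Suc)
  finally show ?case .
qed simp

text \<open>\<open>rot\<close> turns to the right and \<open>rotate\<close> to the left, but a right
  turn by \<open>j\<close> is a left turn by \<open>-j\<close> modulo the length, so both reach the
  same words.\<close>

lemma cyc_avoids_iff: "cyc_avoids n m W \<longleftrightarrow> (\<forall>j. \<not> contains_tau n m (rotate j W))"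
proof (cases "W = []")
  case True then show ?thesis by (simp add: cyc_avoids_def rot_funpow)
next
  case False
  have "(rot ^^ j) W = rotate (length W - j mod length W) W" for j
    by (simp add: rot_funpow rotate_rev)
  moreover have "rotate j W = (rot ^^ (length W - j mod length W)) W" for j
  proof -
    have "(length W - (length W - j mod length W) mod length W) mod length W = j mod length W"
      using False by (cases "j mod length W = 0") auto
    then show ?thesis unfolding calculation by (metis rotate_conv_mod)
  qed
  ultimately show ?thesis unfolding cyc_avoids_def by metis
qed

lemma cyc_avoids_rotate: "cyc_avoids n m (rotate b V) \<longleftrightarrow> cyc_avoids n m V"
proof (cases "V = []")
  case False
  \<comment> \<open>The extra \<open>b * (length V - 1)\<close> steps complete \<open>b\<close> full
    turns.\<close>
  have "rotate (j + b * (length V - 1)) (rotate b V) = rotate j V" for j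
  proof -
    have "j + b * (length V - 1) + b = j + b * length V"
      using False by (cases V) (auto simp: algebra_simps)
    then have "rotate (j + b * (length V - 1)) (rotate b V) = rotate (j + b * length V) V"
      by (simp only: rotate_rotate)
    also have "\<dots> = rotate j V"
      by (subst rotate_conv_mod, subst (2) rotate_conv_mod) simp
    finally show ?thesis .
  qed
  then show ?thesis unfolding cyc_avoids_iff by (metis rotate_rotate)
qed simp

text \<open>If the first and last letters differ, then no run wraps around, and cutting the word open
  elsewhere can only split a run.\<close>

lemma cyc_avoids_hd_last:
  assumes m: "0 < m" and V: "V \<noteq> []" "hd V \<noteq> last V"
  shows "cyc_avoids n m V \<longleftrightarrow> \<not> contains_tau n m V"
proof -
  have "occ_letter n m V a" if o: "occ_letter n m (rotate j V) a" for j a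
  proof -
    define A B where "A = take (j mod length V) V" and "B = drop (j mod length V) V"
    have V': "V = A @ B" and o': "occ_letter n m (B @ A) a"
      using o by (auto simp: A_def B_def rotate_drop_take)
    obtain rA rB where rA: "runlist rA" "expand rA = A" and rB: "runlist rB" "expand rB = B"
      using expand_surj by metis
    show ?thesis
    proof (cases "A = [] \<or> B = []")
      case True then show ?thesis using o' V' by auto
    next
      case False
      then have "rA \<noteq> []" "rB \<noteq> []" using rA rB by auto
      then have "fst (last rB) \<noteq> fst (hd rA)"
        using V V' False rA rB last_expand[of rB] hd_expand[of rA] by auto
      then have "runlist (rB @ rA)" using rA rB by (simp add: runlist_append)
      then have "n \<le> (\<Sum>c \<leftarrow> blocks a rB. c div m) + (\<Sum>c \<leftarrow> blocks a rA. c div m)"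
        using o' occ_letter_expand[OF m, of "rB @ rA" n a] rA rB by simp
      \<comment> \<open>The two pieces together hold at least \<open>n\<close> blocks, and each
        keeps its own in \<open>A @ B\<close>, whatever happens at the seam.\<close>
      then obtain n1 n2 where "n = n1 + n2" "n1 \<le> (\<Sum>c \<leftarrow> blocks a rA. c div m)"
         "n2 \<le> (\<Sum>c \<leftarrow> blocks a rB. c div m)"
        by (metis add.commute le_add1 le_add_diff_inverse nat_le_linear nat_le_iff_add le_diff_conv)
      then show ?thesis using rA rB V' occ_letter_append[OF m] occ_letter_expand[OF m] by metis
    qed
  qed
  then show ?thesis unfolding cyc_avoids_iff contains_tau_def
    by (metis rotate0 id_apply)
qed

section \<open>Interleavings and Laguerre polynomials\<close>

text \<open>Formally the integral of \<open>e^(-t) q(t) / t\<close>. As \<open>tinv\<close> discards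
  the remainder, \<open>Lap\<close> is linear on all polynomials, so sums pass through it before any
  divisibility is known.\<close>

definition Lap :: "real poly \<Rightarrow> real" where
  "Lap q = Phi (tinv q)"

lemma Phi_eq_sum: "degree q \<le> N \<Longrightarrow> Phi q = (\<Sum>j \<le> N. coeff q j * fact j)"
  unfolding Phi_def by (intro sum.mono_neutral_left) (auto simp: coeff_eq_0)

lemma Phi_add: "Phi (p + q) = Phi p + Phi q"
  using Phi_eq_sum[of p "max (degree p) (degree q)"] Phi_eq_sum[of q "max (degree p) (degree q)"]
    Phi_eq_sum[of "p + q" "max (degree p) (degree q)"] degree_add_le_max[of p q]
  by (simp add: sum.distrib algebra_simps)

lemma Phi_0 [simp]: "Phi 0 = 0"
  by (simp add: Phi_def)

lemma Phi_1 [simp]: "Phi 1 = 1"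
  by (simp add: Phi_def)

lemma Phi_smult: "Phi (smult c q) = c * Phi q"
  using Phi_eq_sum[of "smult c q" "degree q"]
  by (simp add: Phi_def sum_distrib_left algebra_simps degree_smult_le)

lemma Phi_sum: "Phi (\<Sum>x \<in> A. f x) = (\<Sum>x \<in> A. Phi (f x))"
  by (induction A rule: infinite_finite_induct) (auto simp: Phi_add)

text \<open>Integration by parts for \<open>\<Phi>(q) = \<integral>\<^sub>0\<^sup>\<infinity> e\<^sup>-\<^sup>t q(t) dt\<close>.\<close>

lemma Phi_pderiv: "Phi (pderiv q) = Phi q - coeff q 0"
proof -
  have "Phi (pderiv q) = (\<Sum>j \<le> degree q. coeff (pderiv q) j * fact j)"
    by (intro Phi_eq_sum) (simp add: degree_pderiv)
  also have "\<dots> = (\<Sum>j \<le> degree q. coeff q (Suc j) * fact (Suc j))"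
    by (simp add: coeff_pderiv algebra_simps)
  also have "\<dots> = (\<Sum>j \<le> Suc (degree q). coeff q j * fact j) - coeff q 0"
    by (subst sum.atMost_Suc_shift) simp
  also have "(\<Sum>j \<le> Suc (degree q). coeff q j * fact j) = Phi q"
    by (rule Phi_eq_sum [symmetric]) simp
  finally show ?thesis .
qed

lemma Lap_add: "Lap (p + q) = Lap p + Lap q"
  by (simp add: Lap_def tinv_def poly_div_add_left Phi_add)

lemma Lap_0 [simp]: "Lap 0 = 0"
  by (simp add: Lap_def tinv_def)

lemma Lap_smult: "Lap (smult c q) = c * Lap q"
  by (simp add: Lap_def tinv_def div_smult_left Phi_smult)

lemma Lap_sum: "Lap (\<Sum>x \<in> A. f x) = (\<Sum>x \<in> A. Lap (f x))"
  by (induction A rule: infinite_finite_induct) (auto simp: Lap_add)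

lemma Lap_times_t: "Lap ([:0, 1:] * q) = Phi q"
  unfolding Lap_def tinv_def by (subst nonzero_mult_div_cancel_left) auto

section \<open>The polynomials \<open>lpoly\<close> and their generating function
  \<open>exp (t * gfps)\<close>\<close>

definition gfps :: "real fps" where
  "gfps = fps_X / (1 + fps_X)"

lemma gfps_mult: "gfps * (1 + fps_X) = fps_X"
  by (simp add: gfps_def fps_divide_unit inverse_mult_eq_1 mult.assoc)

lemma gfps_power_nth_0: "gfps ^ j $ p = 0" if "p < j"
proof -
  have "gfps $ 0 = 0" using arg_cong[OF gfps_mult, of "\<lambda>f. f $ 0"] by simp
  then show ?thesis using that by (intro startsby_zero_power_prefix[rule_format]) auto
qed

text \<open>The series \<open>gfps\<close> has no constant term, so the index set in
  \<open>lpoly\<close> is finite and the sum picks out a single coefficient.\<close>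

lemma coeff_lpoly: "coeff (lpoly p) j = gfps ^ j $ p / fact j"
proof -
  have "j \<le> p" if "gfps ^ j $ p \<noteq> 0" for j
    using that gfps_power_nth_0[of p j] by (cases "p < j") auto
  then have "{j. gfps ^ j $ p \<noteq> 0} \<subseteq> {..p}" by blast
  then have fin: "finite {j. gfps ^ j $ p \<noteq> 0}" by (rule finite_subset) simp
  have "coeff (lpoly p) j = (\<Sum>i \<in> {i. gfps ^ i $ p \<noteq> 0}. if i = j then gfps ^ i $ p / fact i else 0)"
    unfolding lpoly_def gfps_def[symmetric] coeff_sum by (intro sum.cong) auto
  also have "\<dots> = gfps ^ j $ p / fact j"
    using fin by (simp add: sum.delta)
  finally show ?thesis .
qed

lemma lpoly_0 [simp]: "lpoly 0 = 1"
  by (rule poly_eqI) (use gfps_power_nth_0[of 0] in \<open>auto simp: coeff_lpoly\<close>)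

text \<open>This makes the boundary term vanish when \<open>Phi_pderiv\<close> is applied to a
  product with some \<open>p > 0\<close>.\<close>

lemma coeff_lpoly_0: "coeff (lpoly p) 0 = (if p = 0 then 1 else 0)"
  by (simp add: coeff_lpoly)

lemma coeff_pderiv_lpoly: "coeff (pderiv (lpoly p)) j = gfps ^ Suc j $ p / fact j"
  by (simp add: coeff_pderiv coeff_lpoly fact_Suc nonzero_mult_divide_mult_cancel_left
      del: of_nat_Suc power_Suc)

text \<open>Differentiating \<open>exp (t * gfps)\<close> in \<open>t\<close> multiplies it by
  \<open>y / (1 + y)\<close>; clear the denominator and compare coefficients of
  \<open>y^(p+1)\<close>.\<close>

lemma pderiv_lpoly: "pderiv (lpoly (Suc p)) + pderiv (lpoly p) = lpoly p"
proof (rule poly_eqI)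
  fix j
  have "gfps ^ Suc j * (1 + fps_X) = fps_X * gfps ^ j"
    using gfps_mult by (simp add: mult_ac)
  from arg_cong[OF this, of "\<lambda>f. f $ Suc p"]
  have "gfps ^ Suc j $ Suc p + gfps ^ Suc j $ p = gfps ^ j $ p"
    by (simp add: distrib_left del: power_Suc)
  then show "coeff (pderiv (lpoly (Suc p)) + pderiv (lpoly p)) j = coeff (lpoly p) j"
    by (simp add: coeff_pderiv_lpoly coeff_lpoly add.commute del: power_Suc flip: add_divide_distrib)
qed

text \<open>Differentiate \<open>gfps * (1 + y) = y\<close> and multiply by
  \<open>y\<close>.\<close>

lemma gfps_deriv: "fps_X * (1 + fps_X) * fps_deriv gfps = gfps"
proof -
  have "fps_deriv gfps * (1 + fps_X) + gfps = 1"
    using arg_cong[OF gfps_mult, of fps_deriv] by (simp add: algebra_simps)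
  then have "fps_X * (fps_deriv gfps * (1 + fps_X) + gfps) = gfps * (1 + fps_X)"
    by (simp only: gfps_mult mult_1_right)
  then show ?thesis by (simp add: algebra_simps)
qed

text \<open>By \<open>gfps_deriv\<close>, the operator \<open>y (1 + y) d/dy\<close> acts on
  \<open>exp (t * gfps)\<close> as multiplication by \<open>t * gfps\<close>, that is, as
  \<open>t d/dt\<close>. Compare coefficients of \<open>y^(p+1)\<close>.\<close>

lemma lpoly_recurrence:
  "smult (real (Suc p)) (lpoly (Suc p)) + smult (real p) (lpoly p) = [:0, 1:] * pderiv (lpoly (Suc p))"
proof (rule poly_eqI)
  fix j
  have D: "fps_X * (1 + fps_X) * fps_deriv (gfps ^ j) = of_nat j * gfps ^ j"
  proof (cases j)
    case (Suc j')
    have "fps_X * (1 + fps_X) * fps_deriv (gfps ^ j)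
        = of_nat j * (fps_X * (1 + fps_X) * fps_deriv gfps) * gfps ^ j'"
      by (simp only: fps_deriv_power' Suc diff_Suc_1 mult_ac)
    also have "\<dots> = of_nat j * gfps ^ j"
      unfolding gfps_deriv by (simp only: Suc power_Suc mult.assoc)
    finally show ?thesis .
  qed simp
  have "(fps_X * (1 + fps_X) * fps_deriv F) $ Suc p = real (Suc p) * F $ Suc p + real p * F $ p" for F :: "real fps"
    by (cases p) (simp_all add: distrib_left distrib_right mult.assoc)
  from this[of "gfps ^ j"] have "real (Suc p) * gfps ^ j $ Suc p + real p * gfps ^ j $ p = real j * gfps ^ j $ Suc p"
    unfolding D by (simp add: fps_mult_of_nat_nth(1))
  then show "coeff (smult (real (Suc p)) (lpoly (Suc p)) + smult (real p) (lpoly p)) j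
      = coeff ([:0, 1:] * pderiv (lpoly (Suc p))) j"
    by (cases j) (simp_all add: coeff_pderiv coeff_lpoly coeff_pCons field_simps del: of_nat_Suc power_Suc)
qed

text \<open>The interleavings of the factorizations \<open>\<phi> j\<close> without adjacent parts of the same letter.\<close>

definition shuf :: "'a set \<Rightarrow> ('a \<Rightarrow> nat list) \<Rightarrow> ('a \<times> nat) list set" where
  "shuf K \<phi> = {rl. fst ` set rl \<subseteq> K \<and> distinct_adj (map fst rl) \<and> (\<forall>j \<in> K. blocks j rl = \<phi> j)}"

definition shuf_hd :: "'a \<Rightarrow> 'a set \<Rightarrow> ('a \<Rightarrow> nat list) \<Rightarrow> ('a \<times> nat) list set" where
  "shuf_hd i K \<phi> = {rl \<in> shuf K \<phi>. rl \<noteq> [] \<and> fst (hd rl) = i}"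

lemma Nil_in_shuf_iff: "[] \<in> shuf K \<phi> \<longleftrightarrow> (\<forall>j \<in> K. \<phi> j = [])"
  by (auto simp: shuf_def)

lemma shuf_eq_Nil: "(\<forall>j \<in> K. \<phi> j = []) \<Longrightarrow> shuf K \<phi> = {[]}"
proof -
  assume a: "\<forall>j \<in> K. \<phi> j = []"
  have "rl = []" if "rl \<in> shuf K \<phi>" for rl
    using that a by (cases rl) (auto simp: shuf_def)
  then show ?thesis using a Nil_in_shuf_iff by blast
qed

lemma shuf_eq_UN:
  assumes "j \<in> K" "\<phi> j \<noteq> []"
  shows "shuf K \<phi> = (\<Union>i \<in> K. shuf_hd i K \<phi>)"
proof -
  have "rl \<noteq> [] \<and> fst (hd rl) \<in> K" if "rl \<in> shuf K \<phi>" for rl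
    using that assms by (cases rl) (auto simp: shuf_def)
  then show ?thesis by (auto simp: shuf_hd_def)
qed

lemma shuf_hd_empty:
  assumes "i \<in> K" "\<phi> i = []"
  shows "shuf_hd i K \<phi> = {}"
proof -
  have "blocks i rl \<noteq> []" if "rl \<noteq> []" "fst (hd rl) = i" for rl
    using that by (cases rl) auto
  then show ?thesis using assms by (fastforce simp: shuf_hd_def shuf_def)
qed

text \<open>Removing the first part leaves an interleaving that does not begin with \<open>i\<close>
  again. This is the recurrence \<open>C_i(p) = C(p - e_i) - C_i(p - e_i)\<close>.\<close>

lemma Cons_in_shuf:
  assumes "i \<in> K" "\<phi> i = c # cs"
  shows "(a, d) # rl \<in> shuf_hd i K \<phi> \<longleftrightarrow>
    a = i \<and> d = c \<and> rl \<in> shuf K (\<phi>(i := cs)) - shuf_hd i K (\<phi>(i := cs))"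
  using assms by (cases "rl = []") (auto simp: shuf_hd_def shuf_def distinct_adj_Cons hd_map)

lemma shuf_hd_eq:
  assumes "i \<in> K" "\<phi> i = c # cs"
  shows "shuf_hd i K \<phi> = Cons (i, c) ` (shuf K (\<phi>(i := cs)) - shuf_hd i K (\<phi>(i := cs)))"
proof (rule set_eqI)
  fix rl
  show "rl \<in> shuf_hd i K \<phi> \<longleftrightarrow> rl \<in> Cons (i, c) ` (shuf K (\<phi>(i := cs)) - shuf_hd i K (\<phi>(i := cs)))"
  proof (cases rl)
    case Nil then show ?thesis by (auto simp: shuf_hd_def)
  next
    case (Cons b r)
    then show ?thesis using Cons_in_shuf[where K = K and i = i and \<phi> = \<phi>, OF assms, of "fst b" "snd b" r] by (cases b) auto
  qed
qed

lemma prod_length_fun_upd: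
  assumes "finite K" "i \<in> K"
  shows "(\<Prod>j \<in> K. l (length ((\<phi>(i := cs)) j))) = l (length cs) * (\<Prod>j \<in> K - {i}. l (length (\<phi> j)))"
  using assms by (simp add: prod.remove)

text \<open>Joint induction on the total number of parts: the counts by first letter come from
  smaller \<open>\<phi>\<close>, and the full count is then their sum.\<close>

lemma card_shuf_aux:
  fixes K :: "'a set"
  assumes K: "finite K"
  shows "finite (shuf K \<phi>) \<and> real (card (shuf K \<phi>)) = Phi (\<Prod>j \<in> K. lpoly (length (\<phi> j))) \<and>
     (\<forall>i \<in> K. real (card (shuf_hd i K \<phi>)) =
        Phi (pderiv (lpoly (length (\<phi> i))) * (\<Prod>j \<in> K - {i}. lpoly (length (\<phi> j)))))"
proof (induction "\<Sum>j \<in> K. length (\<phi> j)" arbitrary: \<phi> rule: less_induct)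
  case less
  have hd: "finite (shuf_hd i K \<phi>) \<and> real (card (shuf_hd i K \<phi>)) =
        Phi (pderiv (lpoly (length (\<phi> i))) * (\<Prod>j \<in> K - {i}. lpoly (length (\<phi> j))))" if i: "i \<in> K" for i
  proof (cases "\<phi> i")
    case Nil then show ?thesis by (simp add: shuf_hd_empty i pderiv_1)
  next
    case (Cons c cs)
    define \<psi> where "\<psi> = \<phi>(i := cs)"
    define R where "R = (\<Prod>j \<in> K - {i}. lpoly (length (\<phi> j)))"
    have "(\<Sum>j \<in> K. length (\<psi> j)) < (\<Sum>j \<in> K. length (\<phi> j))"
      using i K by (intro sum_strict_mono_ex1) (auto simp: \<psi>_def Cons)
    note IH = less[OF this]
    have sub: "shuf_hd i K \<psi> \<subseteq> shuf K \<psi>" by (auto simp: shuf_hd_def)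
    have "real (card (shuf_hd i K \<phi>)) = real (card (shuf K \<psi> - shuf_hd i K \<psi>))"
      unfolding shuf_hd_eq[where K = K and i = i and \<phi> = \<phi>, OF i Cons] \<psi>_def[symmetric]
      by (simp add: card_image)
    also have "\<dots> = real (card (shuf K \<psi>)) - real (card (shuf_hd i K \<psi>))"
      using IH sub by (simp add: card_Diff_subset finite_subset card_mono of_nat_diff)
    also have "real (card (shuf K \<psi>)) = Phi (lpoly (length cs) * R)"
      using IH prod_length_fun_upd[OF K i, of lpoly \<phi> cs] by (simp only: \<psi>_def R_def)
    also have "real (card (shuf_hd i K \<psi>)) = Phi (pderiv (lpoly (length cs)) * R)"
    proof -
      have "(\<Prod>j \<in> K - {i}. lpoly (length (\<psi> j))) = R"
        unfolding R_def \<psi>_def by (intro prod.cong) auto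
      moreover have "\<psi> i = cs" by (simp add: \<psi>_def)
      ultimately show ?thesis using IH i by simp
    qed
    also have "Phi (lpoly (length cs) * R) - Phi (pderiv (lpoly (length cs)) * R)
        = Phi (pderiv (lpoly (length (\<phi> i))) * R)"
    proof -
      have "lpoly (length cs) * R = pderiv (lpoly (length (\<phi> i))) * R + pderiv (lpoly (length cs)) * R"
        using pderiv_lpoly[of "length cs"] by (simp add: Cons flip: distrib_right)
      then show ?thesis by (simp add: Phi_add)
    qed
    finally show ?thesis
      unfolding shuf_hd_eq[where K = K and i = i and \<phi> = \<phi>, OF i Cons] \<psi>_def[symmetric]
      using IH by (simp add: R_def)
  qed
  have tot: "finite (shuf K \<phi>) \<and> real (card (shuf K \<phi>)) = Phi (\<Prod>j \<in> K. lpoly (length (\<phi> j)))"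
  proof (cases "\<forall>j \<in> K. \<phi> j = []")
    case True
    then show ?thesis by (simp add: shuf_eq_Nil)
  next
    case False
    then obtain j where j: "j \<in> K" "\<phi> j \<noteq> []" by blast
    let ?P = "\<Prod>j \<in> K. lpoly (length (\<phi> j))"
    have "card (shuf K \<phi>) = (\<Sum>i \<in> K. card (shuf_hd i K \<phi>))"
      unfolding shuf_eq_UN[of j K \<phi>, OF j] using K hd
      by (intro card_UN_disjoint) (auto simp: shuf_hd_def)
    then have "real (card (shuf K \<phi>)) = (\<Sum>i \<in> K. real (card (shuf_hd i K \<phi>)))" by simp
    also have "\<dots> = (\<Sum>i \<in> K. Phi ((\<Prod>j \<in> K - {i}. lpoly (length (\<phi> j))) * pderiv (lpoly (length (\<phi> i)))))"
      using hd by (intro sum.cong) (auto simp: mult.commute)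
    \<comment> \<open>By the Leibniz rule, the sum over the first letter is the derivative of the
      whole product. Integration by parts returns the product, since a nonempty
      \<open>\<phi> j\<close> makes the constant coefficient zero.\<close>
    also have "\<dots> = Phi (pderiv ?P)" by (simp add: pderiv_prod Phi_sum)
    also have "\<dots> = Phi ?P - coeff ?P 0" by (rule Phi_pderiv)
    also have "coeff ?P 0 = (\<Prod>j \<in> K. coeff (lpoly (length (\<phi> j))) 0)"
      by (simp add: poly_prod flip: poly_0_coeff_0)
    also have "\<dots> = 0" using K j by (intro prod_zero) (auto simp: coeff_lpoly_0)
    finally show ?thesis using hd K shuf_eq_UN[of j K \<phi>, OF j] by simp
  qed
  show ?case using hd tot by blast
qed

lemma finite_shuf: "finite K \<Longrightarrow> finite (shuf K \<phi>)"
  and card_shuf: "finite K \<Longrightarrow> real (card (shuf K \<phi>)) = Phi (\<Prod>j \<in> K. lpoly (length (\<phi> j)))"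
  and card_shuf_hd: "finite K \<Longrightarrow> i \<in> K \<Longrightarrow> real (card (shuf_hd i K \<phi>)) =
        Phi (pderiv (lpoly (length (\<phi> i))) * (\<Prod>j \<in> K - {i}. lpoly (length (\<phi> j))))"
  using card_shuf_aux[of K \<phi>] by auto

section \<open>Interleavings around a cycle\<close>

definition shuf_cyc :: "'a \<Rightarrow> 'a set \<Rightarrow> ('a \<Rightarrow> nat list) \<Rightarrow> ('a \<times> nat) list set" where
  "shuf_cyc i K \<phi> = {rl \<in> shuf K \<phi>. rl \<noteq> [] \<and> fst (hd rl) = i \<and> fst (last rl) \<noteq> i}"

lemma rev_in_shuf: "rev rl \<in> shuf K (\<lambda>j. rev (\<phi> j)) \<longleftrightarrow> rl \<in> shuf K \<phi>"
proof -
  have "distinct_adj (map fst (rev rl)) \<longleftrightarrow> distinct_adj (map fst rl)"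
    by (metis distinct_adj_rev rev_map)
  then show ?thesis by (simp add: shuf_def)
qed

text \<open>Reversal exchanges the two ends, and the count depends only on the numbers of
  parts.\<close>

lemma card_shuf_last:
  fixes \<phi> :: "'a \<Rightarrow> nat list"
  assumes K: "finite K" and i: "i \<in> K"
  shows "real (card {rl \<in> shuf K \<phi>. rl \<noteq> [] \<and> fst (last rl) = i}) =
     Phi (pderiv (lpoly (length (\<phi> i))) * (\<Prod>j \<in> K - {i}. lpoly (length (\<phi> j))))"
proof -
  have "{rl \<in> shuf K \<phi>. rl \<noteq> [] \<and> fst (last rl) = i} = rev ` shuf_hd i K (\<lambda>j. rev (\<phi> j))"
  proof (rule set_eqI)
    fix rl :: "('a \<times> nat) list"
    have "rl \<in> rev ` shuf_hd i K (\<lambda>j. rev (\<phi> j)) \<longleftrightarrow> rev rl \<in> shuf_hd i K (\<lambda>j. rev (\<phi> j))"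
      by (auto intro: image_eqI[of rl rev "rev rl"])
    then show "rl \<in> {rl \<in> shuf K \<phi>. rl \<noteq> [] \<and> fst (last rl) = i} \<longleftrightarrow> rl \<in> rev ` shuf_hd i K (\<lambda>j. rev (\<phi> j))"
      by (simp add: shuf_hd_def rev_in_shuf hd_rev)
  qed
  then have "card {rl \<in> shuf K \<phi>. rl \<noteq> [] \<and> fst (last rl) = i} = card (shuf_hd i K (\<lambda>j. rev (\<phi> j)))"
    by (simp add: card_image)
  then show ?thesis using card_shuf_hd[OF K i, of "\<lambda>j. rev (\<phi> j)"] by simp
qed

text \<open>Let \<open>D(p)\<close> be the count for \<open>p\<close> parts of \<open>i\<close>,
  \<open>C(p)\<close> that of all interleavings and \<open>E(p)\<close> that of those ending with
  \<open>i\<close>. Prepending a part to interleavings that neither begin nor end with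
  \<open>i\<close> gives \<open>D(p+1) = C(p) - E(p) - D(p)\<close>, and the right-hand side
  satisfies the same rule.\<close>

lemma card_shuf_cyc:
  fixes \<phi> :: "'a \<Rightarrow> nat list"
  assumes K: "finite K" and i: "i \<in> K" and ne: "\<exists>j \<in> K - {i}. \<phi> j \<noteq> []"
  shows "real (card (shuf_cyc i K \<phi>)) =
     Lap (smult (real (length (\<phi> i))) (lpoly (length (\<phi> i))) * (\<Prod>j \<in> K - {i}. lpoly (length (\<phi> j))))"
proof -
  define R where "R = (\<Prod>j \<in> K - {i}. lpoly (length (\<phi> j)))"
  have "real (card (shuf_cyc i K (\<phi>(i := cs)))) = Lap (smult (real (length cs)) (lpoly (length cs)) * R)" for cs
  proof (induction cs)
    case Nil
    have "shuf_cyc i K (\<phi>(i := [])) \<subseteq> shuf_hd i K (\<phi>(i := []))" by (auto simp: shuf_cyc_def shuf_hd_def)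
    then show ?case using shuf_hd_empty[of i K "\<phi>(i := [])"] i
      by (simp only: fun_upd_same subset_empty) simp
  next
    case (Cons c cs)
    define \<psi> where "\<psi> = \<phi>(i := cs)"
    have R: "(\<Prod>j \<in> K - {i}. lpoly (length (\<psi> j))) = R"
      unfolding R_def \<psi>_def by (intro prod.cong) auto
    define E where "E = {rl \<in> shuf K \<psi>. rl \<noteq> [] \<and> fst (last rl) = i}"
    \<comment> \<open>Prepending to the empty interleaving would give a list that both begins and
      ends with \<open>i\<close>.\<close>
    have Nil: "[] \<notin> shuf K \<psi>" using ne by (auto simp: Nil_in_shuf_iff \<psi>_def)
    have sub: "E \<subseteq> shuf K \<psi>" "shuf_cyc i K \<psi> \<subseteq> shuf K \<psi> - E"
      by (auto simp: E_def shuf_cyc_def)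
    have fin: "finite (shuf K \<psi>)" using K by (rule finite_shuf)
    have "rl \<in> shuf_cyc i K (\<phi>(i := c # cs)) \<longleftrightarrow> rl \<in> Cons (i, c) ` (shuf K \<psi> - E - shuf_cyc i K \<psi>)" for rl
    proof (cases rl)
      case Nil then show ?thesis by (auto simp: shuf_cyc_def)
    next
      case (Cons b r)
      obtain a d where b: "b = (a, d)" by (cases b)
      have "rl \<in> shuf_cyc i K (\<phi>(i := c # cs)) \<longleftrightarrow> rl \<in> shuf_hd i K (\<phi>(i := c # cs)) \<and> fst (last rl) \<noteq> i"
        by (auto simp: shuf_cyc_def shuf_hd_def)
      also have "\<dots> \<longleftrightarrow> a = i \<and> d = c \<and> r \<in> shuf K \<psi> - shuf_hd i K \<psi> \<and> fst (last rl) \<noteq> i"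
        using Cons_in_shuf[of i K "\<phi>(i := c # cs)" c cs a d r] i by (simp add: Cons b \<psi>_def)
      also have "\<dots> \<longleftrightarrow> a = i \<and> d = c \<and> r \<in> shuf K \<psi> - E - shuf_cyc i K \<psi>"
        using \<open>[] \<notin> shuf K \<psi>\<close> by (auto simp: E_def shuf_cyc_def shuf_hd_def Cons b)
      finally show ?thesis by (auto simp: Cons b)
    qed
    then have "shuf_cyc i K (\<phi>(i := c # cs)) = Cons (i, c) ` (shuf K \<psi> - E - shuf_cyc i K \<psi>)" by blast
    then have "real (card (shuf_cyc i K (\<phi>(i := c # cs)))) = real (card (shuf K \<psi> - E - shuf_cyc i K \<psi>))"
      by (simp add: card_image)
    also have "\<dots> = real (card (shuf K \<psi>)) - real (card E) - real (card (shuf_cyc i K \<psi>))"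
    proof -
      have "finite E" "finite (shuf_cyc i K \<psi>)" using sub fin by (auto intro: finite_subset)
      moreover have "card (shuf_cyc i K \<psi>) \<le> card (shuf K \<psi> - E)" "card E \<le> card (shuf K \<psi>)"
        using sub fin by (auto intro!: card_mono)
      ultimately show ?thesis using sub by (simp add: card_Diff_subset of_nat_diff)
    qed
    also have "real (card (shuf K \<psi>)) - real (card E) = Phi (lpoly (length cs) * R) - Phi (pderiv (lpoly (length cs)) * R)"
      using card_shuf[OF K, of \<psi>] card_shuf_last[OF K i, of \<psi>] prod_length_fun_upd[OF K i, of lpoly \<phi> cs]
      unfolding E_def R by (simp add: R_def \<psi>_def)
    also have "\<dots> = Phi (pderiv (lpoly (length (c # cs))) * R)"
    proof -
      have "lpoly (length cs) * R = pderiv (lpoly (length (c # cs))) * R + pderiv (lpoly (length cs)) * R"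
        using pderiv_lpoly[of "length cs"] by (simp flip: distrib_right)
      then show ?thesis by (simp add: Phi_add)
    qed
    \<comment> \<open>Multiplying by \<open>t\<close> under \<open>Lap\<close> brings in
      \<open>lpoly_recurrence\<close>, which is where the factor \<open>p\<close> of the claim
      arises.\<close>
    also have "\<dots> = Lap ([:0, 1:] * pderiv (lpoly (length (c # cs))) * R)"
      by (simp only: mult.assoc Lap_times_t)
    also have "\<dots> = Lap (smult (real (length (c # cs))) (lpoly (length (c # cs))) * R)
        + Lap (smult (real (length cs)) (lpoly (length cs)) * R)"
      by (simp only: length_Cons Lap_add [symmetric] distrib_right [symmetric] lpoly_recurrence)
    also have "real (card (shuf_cyc i K \<psi>)) = Lap (smult (real (length cs)) (lpoly (length cs)) * R)"
      using Cons.IH by (simp only: \<psi>_def)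
    finally show ?case by simp
  qed
  from this[of "\<phi> i"] show ?thesis by (simp add: R_def)
qed

section \<open>Cyclically avoiding words with given letter counts\<close>

definition avoiding :: "nat \<Rightarrow> nat \<Rightarrow> nat \<Rightarrow> nat list set" where
  "avoiding n m c = {cs. (\<forall>x \<in> set cs. 0 < x) \<and> sum_list cs = c \<and> \<not> fact_contains n m cs}"

lemma finite_avoiding: "finite (avoiding n m c)"
proof (rule finite_subset)
  have "length cs \<le> sum_list cs" if "\<forall>x \<in> set cs. 0 < x" for cs :: "nat list"
    using that by (induction cs) auto
  then show "avoiding n m c \<subseteq> {cs. set cs \<subseteq> {..c} \<and> length cs \<le> c}"
    by (auto simp: avoiding_def member_le_sum_list)
  show "finite {cs. set cs \<subseteq> {..c} \<and> length cs \<le> c}" by (rule finite_lists_length_le) simp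
qed

text \<open>Group by the first part. Taking \<open>g = real\<close> gives the derivative in
  \<open>v\<close> at 1, and \<open>g = 1\<close> the value at \<open>v = 1\<close>.\<close>

lemma sum_hcnt:
  fixes g :: "nat \<Rightarrow> real"
  shows "(\<Sum>f \<in> {f. hcnt n m c p f \<noteq> 0}. g f * of_nat (hcnt n m c p f))
    = (\<Sum>cs \<in> {cs \<in> avoiding n m c. length cs = p}. g (fst_part cs))"
proof -
  let ?S = "{cs \<in> avoiding n m c. length cs = p}"
  have fin: "finite ?S" using finite_avoiding by simp
  have h: "hcnt n m c p f = card {cs \<in> ?S. fst_part cs = f}" for f
    unfolding hcnt_def avoiding_def by (rule arg_cong[of _ _ card]) auto
  have "{f. hcnt n m c p f \<noteq> 0} \<subseteq> fst_part ` ?S"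
  proof
    fix f assume "f \<in> {f. hcnt n m c p f \<noteq> 0}"
    then have "{cs \<in> ?S. fst_part cs = f} \<noteq> {}" unfolding h by (metis (lifting) card.empty mem_Collect_eq)
    then show "f \<in> fst_part ` ?S" by blast
  qed
  then have "(\<Sum>f \<in> {f. hcnt n m c p f \<noteq> 0}. g f * of_nat (hcnt n m c p f))
     = (\<Sum>f \<in> fst_part ` ?S. g f * of_nat (hcnt n m c p f))"
    using fin by (intro sum.mono_neutral_left) auto
  also have "\<dots> = (\<Sum>f \<in> fst_part ` ?S. \<Sum>cs \<in> {cs \<in> ?S. fst_part cs = f}. g (fst_part cs))"
    by (intro sum.cong) (auto simp: h mult.commute)
  also have "\<dots> = (\<Sum>cs \<in> ?S. g (fst_part cs))"
    using fin by (intro sum.group) auto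
  finally show ?thesis .
qed

text \<open>Regrouping by the number of parts lets each factorization contribute its own
  \<open>lpoly\<close>.\<close>

lemma Tmap_sum:
  assumes S: "finite S" and a: "\<And>p. a p = (\<Sum>x \<in> {x \<in> S. len x = p}. w x)"
  shows "Tmap a = (\<Sum>x \<in> S. smult (w x) (lpoly (len x)))"
proof -
  have "{p. a p \<noteq> 0} \<subseteq> len ` S" by (auto simp: a elim: sum.not_neutral_contains_not_neutral)
  then have "Tmap a = (\<Sum>p \<in> len ` S. smult (a p) (lpoly p))"
    unfolding Tmap_def using S by (intro sum.mono_neutral_left) auto
  also have "\<dots> = (\<Sum>p \<in> len ` S. \<Sum>x \<in> {x \<in> S. len x = p}. smult (w x) (lpoly (len x)))"
    by (intro sum.cong) (auto simp: a smult_sum)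
  also have "\<dots> = (\<Sum>x \<in> S. smult (w x) (lpoly (len x)))"
    using S by (intro sum.group) auto
  finally show ?thesis .
qed

lemma TD_nth:
  "TD n m $ c = (\<Sum>cs \<in> avoiding n m c. smult (real (length cs) * real (fst_part cs)) (lpoly (length cs)))"
  unfolding TD_def fps_nth_Abs_fps
  by (intro Tmap_sum finite_avoiding)
    (subst sum_hcnt[where g = real], auto simp: sum_distrib_left intro: sum.cong)

lemma TH_nth: "TH n m $ c = (\<Sum>cs \<in> avoiding n m c. lpoly (length cs))"
proof -
  have "TH n m $ c = (\<Sum>cs \<in> avoiding n m c. smult 1 (lpoly (length cs)))"
    unfolding TH_def fps_nth_Abs_fps
    using sum_hcnt[where g = "\<lambda>_. 1"] by (intro Tmap_sum finite_avoiding) simp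
  then show ?thesis by simp
qed

lemma avoiding_0:
  assumes "0 < m" "0 < n"
  shows "avoiding n m 0 = {[]}"
proof -
  have "cs = []" if "cs \<in> avoiding n m 0" for cs
    using that by (cases cs) (auto simp: avoiding_def)
  moreover have "[] \<in> avoiding n m 0"
    using assms by (simp add: avoiding_def fact_contains_iff)
  ultimately show ?thesis by blast
qed

text \<open>A letter that does not occur contributes a factor 1.\<close>

lemma TH_nth_0: "0 < m \<Longrightarrow> 0 < n \<Longrightarrow> TH n m $ 0 = 1"
  by (simp add: TH_nth avoiding_0)

text \<open>All coefficients of \<open>1 / (1 - X)\<close> are 1; the two powers in the numerator
  switch them on at exponent 1 and off at \<open>m * n\<close>.\<close>

lemma geomser_nth: "geomser n m $ c = (if 0 < c \<and> c < n * m then 1 else 0)"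
  if "0 < m" "0 < n"
proof -
  have inv: "inverse (1 - fps_X :: real fps) = Abs_fps (\<lambda>_. 1)"
    by (metis fps_inverse_gp' fps_inverse_idempotent fps_nth_Abs_fps zero_neq_one)
  have "geomser n m = (fps_X - fps_X ^ (m * n)) * Abs_fps (\<lambda>_. 1)"
    unfolding geomser_def by (subst fps_divide_unit) (auto simp: inv)
  then have "geomser n m $ c = (fps_X * Abs_fps (\<lambda>_. 1)) $ c - (fps_X ^ (m * n) * Abs_fps (\<lambda>_. 1)) $ c"
    by (simp only: left_diff_distrib fps_sub_nth)
  then show ?thesis
    using that by (simp only: fps_X_power_mult_nth fps_X_mult_nth) (auto simp: mult.commute)
qed

section \<open>Words and their rotated run lists\<close>

definition cyc_runs :: "nat \<Rightarrow> nat \<Rightarrow> nat set \<Rightarrow> (nat \<Rightarrow> nat) \<Rightarrow> nat \<Rightarrow> (nat \<times> nat) list set" where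
  "cyc_runs n m K \<alpha> i = {rl. runlist rl \<and> fst ` set rl \<subseteq> K \<and> rl \<noteq> [] \<and> fst (hd rl) = i \<and>
     fst (last rl) \<noteq> i \<and> (\<forall>j \<in> K. blocks j rl \<in> avoiding n m (\<alpha> j))}"

definition cyc_words :: "nat \<Rightarrow> nat \<Rightarrow> nat set \<Rightarrow> (nat \<Rightarrow> nat) \<Rightarrow> nat list set" where
  "cyc_words n m K \<alpha> = {W. set W \<subseteq> K \<and> cyc_avoids n m W \<and> (\<forall>j \<in> K. count_list W j = \<alpha> j)}"

definition cyc_words_hd :: "nat \<Rightarrow> nat \<Rightarrow> nat set \<Rightarrow> (nat \<Rightarrow> nat) \<Rightarrow> nat \<Rightarrow> nat list set" where
  "cyc_words_hd n m K \<alpha> i = {W \<in> cyc_words n m K \<alpha>. W \<noteq> [] \<and> hd W = i}"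

lemma finite_cyc_words:
  assumes "finite K"
  shows "finite (cyc_words n m K \<alpha>)"
proof (rule finite_subset)
  show "cyc_words n m K \<alpha> \<subseteq> {W. set W \<subseteq> K \<and> length W = (\<Sum>j \<in> K. \<alpha> j)}"
  proof
    fix W assume W: "W \<in> cyc_words n m K \<alpha>"
    then have "length W = (\<Sum>j \<in> K. count_list W j)"
      using sum_count_set[of W K] assms by (simp add: cyc_words_def)
    then show "W \<in> {W. set W \<subseteq> K \<and> length W = (\<Sum>j \<in> K. \<alpha> j)}"
      using W by (simp add: cyc_words_def)
  qed
  show "finite {W. set W \<subseteq> K \<and> length W = (\<Sum>j \<in> K. \<alpha> j)}"
    using assms by (rule finite_lists_length_eq)
qed

text \<open>Avoiding factorizations have positive parts, so their interleavings are genuine run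
  lists. Functions in \<open>PiE\<close> are fixed outside \<open>K\<close>, so a run list
  determines \<open>\<phi>\<close> and the union is disjoint.\<close>

lemma cyc_runs_eq_UN:
  assumes "i \<in> K"
  shows "cyc_runs n m K \<alpha> i = (\<Union>\<phi> \<in> PiE K (\<lambda>j. avoiding n m (\<alpha> j)). shuf_cyc i K \<phi>)"
proof (rule set_eqI)
  fix rl :: "(nat \<times> nat) list"
  have pos: "0 < snd b" if "b \<in> set rl" "fst ` set rl \<subseteq> K" "\<forall>j \<in> K. blocks j rl \<in> avoiding n m (\<alpha> j)" for b
  proof -
    have "snd b \<in> set (blocks (fst b) rl)" using that by (auto simp: blocks_def)
    then show ?thesis using that by (auto simp: avoiding_def)
  qed
  define \<phi> where "\<phi> = (\<lambda>j \<in> K. blocks j rl)"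
  have "rl \<in> cyc_runs n m K \<alpha> i \<longleftrightarrow> rl \<in> shuf_cyc i K \<phi> \<and> \<phi> \<in> PiE K (\<lambda>j. avoiding n m (\<alpha> j))"
    using pos by (auto simp: cyc_runs_def shuf_cyc_def shuf_def runlist_def \<phi>_def)
  moreover have "\<psi> = \<phi>" if "\<psi> \<in> PiE K (\<lambda>j. avoiding n m (\<alpha> j))" "rl \<in> shuf_cyc i K \<psi>" for \<psi>
  proof
    fix j show "\<psi> j = \<phi> j"
      using that by (cases "j \<in> K") (auto simp: \<phi>_def shuf_cyc_def shuf_def)
  qed
  ultimately show "rl \<in> cyc_runs n m K \<alpha> i \<longleftrightarrow> rl \<in> (\<Union>\<phi> \<in> PiE K (\<lambda>j. avoiding n m (\<alpha> j)). shuf_cyc i K \<phi>)"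
    by blast
qed

text \<open>The weight is the number of rotations that cut the first run or start with it; it
  accounts for the derivative in \<open>v\<close>. The derivative in \<open>u\<close> comes from the
  number of parts in \<open>card_shuf_cyc\<close>.\<close>

lemma sum_cyc_runs:
  assumes K: "finite K" "i \<in> K" and \<alpha>: "\<exists>j \<in> K - {i}. \<alpha> j \<noteq> 0"
  shows "(\<Sum>rl \<in> cyc_runs n m K \<alpha> i. real (snd (hd rl)))
     = Lap (TD n m $ \<alpha> i * (\<Prod>j \<in> K - {i}. TH n m $ \<alpha> j))"
proof -
  let ?P = "PiE K (\<lambda>j. avoiding n m (\<alpha> j))"
  define f where "f j cs = (if j = i then smult (real (length cs) * real (fst_part cs)) (lpoly (length cs))
    else lpoly (length cs))" for j cs
  have fin: "finite ?P" using K finite_avoiding by (intro finite_PiE) auto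
  have "(\<Sum>rl \<in> cyc_runs n m K \<alpha> i. real (snd (hd rl)))
      = (\<Sum>\<phi> \<in> ?P. \<Sum>rl \<in> shuf_cyc i K \<phi>. real (snd (hd rl)))"
    unfolding cyc_runs_eq_UN[OF K(2)]
  proof (rule sum.UNION_disjoint[OF fin])
    show "\<forall>\<phi> \<in> ?P. finite (shuf_cyc i K \<phi>)"
      using finite_shuf[OF K(1)] by (auto simp: shuf_cyc_def)
    have "\<phi> = \<psi>" if "\<phi> \<in> ?P" "\<psi> \<in> ?P" "rl \<in> shuf_cyc i K \<phi>" "rl \<in> shuf_cyc i K \<psi>" for \<phi> \<psi> rl
      by (rule PiE_ext[OF that(1,2)]) (use that(3,4) in \<open>auto simp: shuf_cyc_def shuf_def\<close>)
    then show "\<forall>\<phi> \<in> ?P. \<forall>\<psi> \<in> ?P. \<phi> \<noteq> \<psi> \<longrightarrow> shuf_cyc i K \<phi> \<inter> shuf_cyc i K \<psi> = {}" by blast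
  qed
  also have "\<dots> = (\<Sum>\<phi> \<in> ?P. Lap (\<Prod>j \<in> K. f j (\<phi> j)))"
  proof (rule sum.cong[OF refl])
    fix \<phi> assume \<phi>: "\<phi> \<in> ?P"
    have "snd (hd rl) = fst_part (\<phi> i)" if "rl \<in> shuf_cyc i K \<phi>" for rl
    proof (cases rl)
      case (Cons b r)
      then have "fst b = i" "blocks i rl = \<phi> i" using that K by (auto simp: shuf_cyc_def shuf_def)
      then have "\<phi> i = snd b # blocks i r" using Cons by (cases b) auto
      then show ?thesis by (simp add: Cons fst_part_def)
    qed (use that in \<open>auto simp: shuf_cyc_def\<close>)
    then have "(\<Sum>rl \<in> shuf_cyc i K \<phi>. real (snd (hd rl))) = real (fst_part (\<phi> i)) * real (card (shuf_cyc i K \<phi>))"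
      by simp
    also obtain j where j: "j \<in> K - {i}" "\<alpha> j \<noteq> 0" using \<alpha> by blast
    \<comment> \<open>A letter that occurs has a part, which is the condition for
      \<open>card_shuf_cyc\<close>.\<close>
    have "\<phi> j \<noteq> []" using j \<phi> by (force simp: avoiding_def PiE_def)
    then have "real (card (shuf_cyc i K \<phi>)) =
       Lap (smult (real (length (\<phi> i))) (lpoly (length (\<phi> i))) * (\<Prod>j \<in> K - {i}. lpoly (length (\<phi> j))))"
      using j by (intro card_shuf_cyc K) blast
    also have "real (fst_part (\<phi> i)) * \<dots> = Lap (f i (\<phi> i) * (\<Prod>j \<in> K - {i}. lpoly (length (\<phi> j))))"
      by (simp add: f_def mult.commute flip: Lap_smult)
    also have "(\<Prod>j \<in> K - {i}. lpoly (length (\<phi> j))) = (\<Prod>j \<in> K - {i}. f j (\<phi> j))"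
      by (intro prod.cong) (auto simp: f_def)
    finally show "(\<Sum>rl \<in> shuf_cyc i K \<phi>. real (snd (hd rl))) = Lap (\<Prod>j \<in> K. f j (\<phi> j))"
      using K by (simp add: prod.remove)
  qed
  also have "\<dots> = Lap (\<Prod>j \<in> K. \<Sum>cs \<in> avoiding n m (\<alpha> j). f j cs)"
    by (simp add: prod_sum_PiE K finite_avoiding Lap_sum)
  also have "(\<Prod>j \<in> K. \<Sum>cs \<in> avoiding n m (\<alpha> j). f j cs) = TD n m $ \<alpha> i * (\<Prod>j \<in> K - {i}. TH n m $ \<alpha> j)"
    using K by (simp add: prod.remove TD_nth TH_nth f_def)
  finally show ?thesis .
qed

lemma count_list_rotate: "count_list (rotate b V) j = count_list V j"
proof (induction b)
  case (Suc b)
  have "count_list (rotate1 U) j = count_list U j" for U by (cases U) auto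
  then show ?case using Suc by simp
qed simp

lemma inj_rotate: "inj (rotate b)"
  by (simp add: rotate_def inj_fn inj_rotate1)

text \<open>A word that is not constant is rotated so that the run containing its first letter is not cut;
  the amount of the rotation ranges over the positions in that run.\<close>

lemma bij_betw_cyc_words_hd:
  assumes mn: "0 < m" "0 < n" and \<alpha>: "\<exists>j \<in> K - {i}. \<alpha> j \<noteq> 0"
  shows "bij_betw (\<lambda>(rl, b). rotate b (expand rl)) (SIGMA rl : cyc_runs n m K \<alpha> i. {..<snd (hd rl)})
    (cyc_words_hd n m K \<alpha> i)"
proof -
  have runs: "\<exists>R. R \<noteq> [] \<and> expand rl = replicate (snd (hd rl)) i @ R \<and> last R \<noteq> i"
    if "rl \<in> cyc_runs n m K \<alpha> i" for rl
  proof -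
    have "rl \<noteq> []" "fst (hd rl) = i" using that by (auto simp: cyc_runs_def)
    then obtain c r where rl: "rl = (i, c) # r" by (cases rl) auto
    then have r: "r \<noteq> []" "runlist r" "fst (last r) \<noteq> i"
      using that by (auto simp: cyc_runs_def runlist_Cons split: if_splits)
    then show ?thesis
      by (intro exI[of _ "expand r"]) (simp add: rl last_expand expand_eq_Nil_iff)
  qed
  \<comment> \<open>Of the first run, \<open>b\<close> letters move to the end and at least one
    stays in front.\<close>
  have rot: "rotate b (expand rl) = replicate (snd (hd rl) - b) i @ R @ replicate b i"
    if "expand rl = replicate (snd (hd rl)) i @ R" "b < snd (hd rl)" for rl R b
  proof -
    have "replicate (snd (hd rl)) i = replicate b i @ replicate (snd (hd rl) - b) i"
      using that(2) by (simp flip: replicate_add)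
    then show ?thesis
      using rotate_append[of "replicate b i" "replicate (snd (hd rl) - b) i @ R"] that(1) by simp
  qed
  have cyc: "cyc_avoids n m (expand rl) \<longleftrightarrow> (\<forall>j \<in> K. \<not> fact_contains n m (blocks j rl))"
    if "runlist rl" "fst ` set rl \<subseteq> K" "rl \<noteq> []" "fst (hd rl) \<noteq> fst (last rl)" for rl
    using that mn cyc_avoids_hd_last[OF mn(1), of "expand rl" n]
    by (simp add: hd_expand last_expand expand_eq_Nil_iff not_contains_tau_expand)
  show ?thesis
  proof (rule bij_betw_imageI)
    have "b = b' \<and> rl = rl'"
      if rl: "rl \<in> cyc_runs n m K \<alpha> i" "b < snd (hd rl)" and rl': "rl' \<in> cyc_runs n m K \<alpha> i" "b' < snd (hd rl')"
        and eq: "rotate b (expand rl) = rotate b' (expand rl')" for rl b rl' b'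
    proof -
      \<comment> \<open>The rotation can be read off as the number of trailing letters
        \<open>i\<close>, because the part before them ends with another letter.\<close>
      have tail: "takeWhile (\<lambda>x. x = i) (rev (rotate b (expand rl))) = replicate b i"
        if rl: "rl \<in> cyc_runs n m K \<alpha> i" "b < snd (hd rl)" for rl b
      proof -
        obtain R where R: "R \<noteq> []" "expand rl = replicate (snd (hd rl)) i @ R" "last R \<noteq> i"
          using runs[OF rl(1)] by blast
        then obtain R' x where "R = R' @ [x]" "x \<noteq> i" by (cases R rule: rev_cases) auto
        then show ?thesis using rot[OF R(2) rl(2)] by (simp add: takeWhile_append)
      qed
      have "b = b'" using tail[OF rl] tail[OF rl'] eq by (metis length_replicate)
      moreover have "expand rl = expand rl'"
        using eq unfolding \<open>b = b'\<close> by (rule injD[OF inj_rotate])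
      ultimately show ?thesis
        using expand_inj rl rl' by (auto simp: cyc_runs_def inj_on_def)
    qed
    then show "inj_on (\<lambda>(rl, b). rotate b (expand rl)) (SIGMA rl : cyc_runs n m K \<alpha> i. {..<snd (hd rl)})"
      by (auto simp: inj_on_def)
    show "(\<lambda>(rl, b). rotate b (expand rl)) ` (SIGMA rl : cyc_runs n m K \<alpha> i. {..<snd (hd rl)})
       = cyc_words_hd n m K \<alpha> i" (is "?f ` ?A = ?B")
    proof (intro equalityI subsetI)
      fix W assume "W \<in> ?f ` ?A"
      then obtain rl b where rl: "rl \<in> cyc_runs n m K \<alpha> i" and b: "b < snd (hd rl)"
        and W: "W = rotate b (expand rl)" by auto
      obtain R where R: "expand rl = replicate (snd (hd rl)) i @ R" using runs[OF rl] by blast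
      have "W \<noteq> [] \<and> hd W = i"
        unfolding W rot[OF R b] using b by simp
      moreover have "set W \<subseteq> K" using rl by (auto simp: W cyc_runs_def set_expand)
      moreover have "cyc_avoids n m W"
        using rl cyc[of rl] by (auto simp: W cyc_avoids_rotate cyc_runs_def avoiding_def)
      moreover have "\<forall>j \<in> K. count_list W j = \<alpha> j"
        using rl by (auto simp: W count_list_rotate count_list_expand cyc_runs_def avoiding_def)
      ultimately show "W \<in> ?B" by (simp add: cyc_words_hd_def cyc_words_def)
    next
      fix W assume "W \<in> ?B"
      then have W: "set W \<subseteq> K" "cyc_avoids n m W" "\<forall>j \<in> K. count_list W j = \<alpha> j" "W \<noteq> []" "hd W = i"
        by (auto simp: cyc_words_hd_def cyc_words_def)
      \<comment> \<open>Inverse map: the trailing letters \<open>i\<close> are moved back to the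
        front. Some other letter occurs, so \<open>U\<close> is nonempty.\<close>
      define b where "b = length (takeWhile (\<lambda>x. x = i) (rev W))"
      define U where "U = rev (dropWhile (\<lambda>x. x = i) (rev W))"
      have "takeWhile (\<lambda>x. x = i) (rev W) = replicate b i"
        unfolding b_def by (rule replicate_eqI) (auto dest: set_takeWhileD)
      then have WU: "W = U @ replicate b i"
        unfolding U_def by (metis rev_append rev_replicate rev_rev_ident takeWhile_dropWhile_id)
      have "U \<noteq> []"
      proof
        assume "U = []"
        then have "set W \<subseteq> {i}" by (auto simp: WU)
        then show False using \<alpha> W(3) by (metis DiffE count_list_0_iff subsetD)
      qed
      then have hdU: "hd U = i" using W(5) WU by simp
      have lastU: "last U \<noteq> i"
        using \<open>U \<noteq> []\<close> hd_dropWhile[of "\<lambda>x. x = i" "rev W"] by (simp add: U_def last_rev)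
      define V where "V = replicate b i @ U"
      have rotV: "rotate b V = W" using rotate_append[of "replicate b i" U] by (simp add: V_def WU)
      obtain rl where rl: "runlist rl" "expand rl = V" using expand_surj by blast
      have V: "V \<noteq> []" "hd V = i" "last V \<noteq> i"
        using \<open>U \<noteq> []\<close> hdU lastU by (auto simp: V_def hd_append)
      then have "rl \<noteq> []" using rl by auto
      then have hl: "fst (hd rl) = i" "fst (last rl) \<noteq> i"
        using V hd_expand[OF rl(1)] last_expand[OF rl(1)] rl(2) by auto
      have sub: "fst ` set rl \<subseteq> K"
        using W(1) rl set_expand[OF rl(1)] by (simp flip: rotV)
      have "cyc_avoids n m V" using W(2) by (simp add: cyc_avoids_rotate flip: rotV)
      then have "\<forall>j \<in> K. \<not> fact_contains n m (blocks j rl)"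
        using cyc[OF rl(1) sub \<open>rl \<noteq> []\<close>] hl rl(2) by auto
      moreover have "\<forall>j \<in> K. sum_list (blocks j rl) = \<alpha> j"
        using W(3) rl(2) by (auto simp: count_list_rotate simp flip: rotV count_list_expand)
      moreover have "\<forall>x \<in> set (blocks j rl). 0 < x" for j
        using rl(1) by (auto simp: blocks_def runlist_def)
      ultimately have "rl \<in> cyc_runs n m K \<alpha> i"
        using rl(1) sub \<open>rl \<noteq> []\<close> hl by (auto simp: cyc_runs_def avoiding_def)
      \<comment> \<open>The first run of \<open>V\<close> contains the \<open>b\<close> moved
        letters and also the first letter of \<open>U\<close>.\<close>
      moreover have "b < snd (hd rl)"
      proof -
        obtain c r where c: "rl = (i, c) # r" using \<open>rl \<noteq> []\<close> hl by (cases rl) auto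
        obtain U' where "U = i # U'" using \<open>U \<noteq> []\<close> hdU by (cases U) auto
        then have "length (takeWhile (\<lambda>x. x = i) V) \<ge> Suc b" by (simp add: V_def takeWhile_append)
        then show ?thesis using takeWhile_expand[of i c r] rl by (simp add: c)
      qed
      ultimately show "W \<in> ?f ` ?A"
        using rotV rl(2) by (intro image_eqI[of _ _ "(rl, b)"]) auto
    qed
  qed
qed

lemma card_cyc_words_hd:
  assumes mn: "0 < m" "0 < n" and K: "finite K" "i \<in> K" and \<alpha>: "\<exists>j \<in> K - {i}. \<alpha> j \<noteq> 0"
  shows "real (card (cyc_words_hd n m K \<alpha> i)) = Lap (TD n m $ \<alpha> i * (\<Prod>j \<in> K - {i}. TH n m $ \<alpha> j))"
proof -
  let ?A = "cyc_runs n m K \<alpha> i"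
  have bij: "bij_betw (\<lambda>(rl, b). rotate b (expand rl)) (SIGMA rl : ?A. {..<snd (hd rl)}) (cyc_words_hd n m K \<alpha> i)"
    by (rule bij_betw_cyc_words_hd[OF mn \<alpha>])
  have "finite (cyc_words_hd n m K \<alpha> i)"
    using finite_cyc_words[OF K(1)] by (simp add: cyc_words_hd_def)
  then have fin: "finite (SIGMA rl : ?A. {..<snd (hd rl)})"
    using bij bij_betw_finite by blast
  \<comment> \<open>First runs have positive length, so every run list appears in the finite set of
    pairs.\<close>
  have "?A \<subseteq> fst ` (SIGMA rl : ?A. {..<snd (hd rl)})"
  proof
    fix rl assume rl: "rl \<in> ?A"
    then have "0 < snd (hd rl)" by (auto simp: cyc_runs_def runlist_def)
    then have "(rl, 0) \<in> (SIGMA rl : ?A. {..<snd (hd rl)})" using rl by simp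
    then show "rl \<in> fst ` (SIGMA rl : ?A. {..<snd (hd rl)})" by force
  qed
  then have "finite ?A" using fin finite_surj by blast
  then have "card (SIGMA rl : ?A. {..<snd (hd rl)}) = (\<Sum>rl \<in> ?A. snd (hd rl))" by simp
  then have "card (cyc_words_hd n m K \<alpha> i) = (\<Sum>rl \<in> ?A. snd (hd rl))"
    using bij_betw_same_card[OF bij] by simp
  then show ?thesis using sum_cyc_runs[OF K \<alpha>] by simp
qed

lemma cyc_avoids_replicate:
  assumes mn: "0 < m" "0 < n"
  shows "cyc_avoids n m (replicate c i) \<longleftrightarrow> c < n * m"
proof (cases "c = 0")
  case True
  then show ?thesis
    using mn not_contains_tau_expand[OF mn, of "[]" "{}"] by (simp add: cyc_avoids_iff)
next
  case False
  have "rotate j (replicate c i) = replicate c i" for j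
    by (intro replicate_eqI) auto
  then have "cyc_avoids n m (replicate c i) \<longleftrightarrow> \<not> contains_tau n m (expand [(i, c)])"
    by (simp add: cyc_avoids_iff)
  also have "\<dots> \<longleftrightarrow> \<not> n \<le> c div m"
    using False mn not_contains_tau_expand[OF mn, of "[(i, c)]" "{i}"]
    by (simp add: runlist_Cons fact_contains_iff)
  also have "\<dots> \<longleftrightarrow> c < n * m"
    using mn by (simp add: not_le div_less_iff_less_mult)
  finally show ?thesis .
qed

text \<open>These are the constant words, whose only run wraps around, so the bijection does not
  apply. They make up the last sum of the formula.\<close>

lemma card_cyc_words_hd_const:
  assumes mn: "0 < m" "0 < n" and K: "i \<in> K" and \<alpha>: "\<forall>j \<in> K - {i}. \<alpha> j = 0"
  shows "real (card (cyc_words_hd n m K \<alpha> i)) = geomser n m $ \<alpha> i"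
proof -
  have mem: "W \<in> cyc_words_hd n m K \<alpha> i \<longleftrightarrow> W = replicate (\<alpha> i) i \<and> 0 < \<alpha> i \<and> \<alpha> i < n * m" for W
  proof
    assume W: "W \<in> cyc_words_hd n m K \<alpha> i"
    then have "set W \<subseteq> {i}"
      using \<alpha> by (auto simp: cyc_words_hd_def cyc_words_def) (metis DiffI count_list_0_iff singletonD subsetD)
    moreover have cnt: "count_list W i = \<alpha> i" using W K by (simp add: cyc_words_hd_def cyc_words_def)
    moreover have "length W = \<alpha> i" using sum_count_set[OF calculation(1)] cnt by simp
    ultimately have "W = replicate (\<alpha> i) i" by (intro replicate_eqI) auto
    then show "W = replicate (\<alpha> i) i \<and> 0 < \<alpha> i \<and> \<alpha> i < n * m"
      using W mn by (auto simp: cyc_words_hd_def cyc_words_def cyc_avoids_replicate)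
  next
    assume a: "W = replicate (\<alpha> i) i \<and> 0 < \<alpha> i \<and> \<alpha> i < n * m"
    have "count_list (replicate c i) j = (if j = i then c else 0)" for c j
      by (induction c) auto
    then show "W \<in> cyc_words_hd n m K \<alpha> i"
      using a \<alpha> mn K by (auto simp: cyc_words_hd_def cyc_words_def cyc_avoids_replicate)
  qed
  have "cyc_words_hd n m K \<alpha> i = (if 0 < \<alpha> i \<and> \<alpha> i < n * m then {replicate (\<alpha> i) i} else {})"
    by (rule set_eqI) (simp add: mem)
  then show ?thesis using mn by (simp add: geomser_nth)
qed

text \<open>The products of coefficients of the series \<open>1\<close> serve as indicators of \<open>\<alpha> j = 0\<close>, in a form that
  can be summed over \<open>\<alpha>\<close>.\<close>

lemma prod_fps_one_nth:
  "finite K \<Longrightarrow> (\<Prod>j \<in> K. (1 :: 'a::comm_ring_1 fps) $ \<alpha> j) = (if \<forall>j \<in> K. \<alpha> j = 0 then 1 else 0)"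
  by (induction K rule: finite_induct) auto

text \<open>Words are sorted by their first letter \<open>i\<close>. Subtracting the product of ones
  removes the case in which only \<open>i\<close> occurs, which the \<open>geomser\<close> term
  covers instead.\<close>

lemma card_cyc_words:
  assumes mn: "0 < m" "0 < n" and K: "finite K"
  shows "real (card (cyc_words n m K \<alpha>)) = (\<Prod>j \<in> K. (1 :: real fps) $ \<alpha> j)
    + (\<Sum>i \<in> K. Lap (TD n m $ \<alpha> i * ((\<Prod>j \<in> K - {i}. TH n m $ \<alpha> j) - (\<Prod>j \<in> K - {i}. 1 $ \<alpha> j))))
    + (\<Sum>i \<in> K. geomser n m $ \<alpha> i * (\<Prod>j \<in> K - {i}. 1 $ \<alpha> j))"
proof -
  let ?N = "{W \<in> cyc_words n m K \<alpha>. W = []}"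
  have hd: "real (card (cyc_words_hd n m K \<alpha> i))
     = Lap (TD n m $ \<alpha> i * ((\<Prod>j \<in> K - {i}. TH n m $ \<alpha> j) - (\<Prod>j \<in> K - {i}. 1 $ \<alpha> j)))
       + geomser n m $ \<alpha> i * (\<Prod>j \<in> K - {i}. 1 $ \<alpha> j)" if i: "i \<in> K" for i
  proof (cases "\<forall>j \<in> K - {i}. \<alpha> j = 0")
    case True
    then show ?thesis
      using card_cyc_words_hd_const[OF mn i True] K mn by (simp add: prod_fps_one_nth TH_nth_0)
  next
    case False
    then have "(\<Prod>j \<in> K - {i}. (1 :: real fps) $ \<alpha> j) = 0" "(\<Prod>j \<in> K - {i}. (1 :: real poly fps) $ \<alpha> j) = 0"
      using K by (subst prod_fps_one_nth; auto)+
    then show ?thesis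
      using False card_cyc_words_hd[OF mn K i, of \<alpha>] by (simp del: fps_one_nth)
  qed
  have "cyc_avoids n m []" using cyc_avoids_replicate[OF mn, of 0] mn by simp
  then have N: "?N = (if \<forall>j \<in> K. \<alpha> j = 0 then {[]} else {})"
    by (auto simp: cyc_words_def)
  have "cyc_words n m K \<alpha> = ?N \<union> (\<Union>i \<in> K. cyc_words_hd n m K \<alpha> i)"
  proof -
    have "hd W \<in> K" if "W \<in> cyc_words n m K \<alpha>" "W \<noteq> []" for W
      using that by (auto simp: cyc_words_def)
    then show ?thesis by (auto simp: cyc_words_hd_def)
  qed
  also have "card \<dots> = card ?N + card (\<Union>i \<in> K. cyc_words_hd n m K \<alpha> i)"
    using K finite_cyc_words[OF K, of n m \<alpha>] by (intro card_Un_disjoint) (auto simp: cyc_words_hd_def)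
  also have "card (\<Union>i \<in> K. cyc_words_hd n m K \<alpha> i) = (\<Sum>i \<in> K. card (cyc_words_hd n m K \<alpha> i))"
    using K finite_cyc_words[OF K, of n m \<alpha>] by (intro card_UN_disjoint) (auto simp: cyc_words_hd_def)
  finally have "real (card (cyc_words n m K \<alpha>)) = real (card ?N) + (\<Sum>i \<in> K. real (card (cyc_words_hd n m K \<alpha> i)))"
    by simp
  also have "(\<Sum>i \<in> K. real (card (cyc_words_hd n m K \<alpha> i)))
     = (\<Sum>i \<in> K. Lap (TD n m $ \<alpha> i * ((\<Prod>j \<in> K - {i}. TH n m $ \<alpha> j) - (\<Prod>j \<in> K - {i}. 1 $ \<alpha> j)))
       + geomser n m $ \<alpha> i * (\<Prod>j \<in> K - {i}. 1 $ \<alpha> j))"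
    by (intro sum.cong) (auto simp: hd)
  also have "real (card ?N) = (\<Prod>j \<in> K. (1 :: real fps) $ \<alpha> j)"
    using K by (simp add: N prod_fps_one_nth)
  finally show ?thesis by (simp add: sum.distrib)
qed


section \<open>Generating functions\<close>

text \<open>The factor \<open>memb i F\<close> allows only exponents concentrated at
  \<open>i\<close>, and \<open>G\<close> does not involve the variable of \<open>i\<close>, so one
  term survives. Finite support of \<alpha> makes the sum in \<open>mmult\<close> finite.\<close>

lemma mmult_memb:
  assumes fin: "finite {j. \<alpha> j \<noteq> 0}" and G: "\<And>\<gamma>. \<forall>j. \<gamma> j \<le> \<alpha> j \<Longrightarrow> \<gamma> i \<noteq> 0 \<Longrightarrow> G \<gamma> = 0"
  shows "mmult (memb i F) G \<alpha> = F $ \<alpha> i * G (\<alpha>(i := 0))"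
proof -
  let ?B = "{\<beta>. \<forall>j. \<beta> j \<le> \<alpha> j}"
  \<comment> \<open>The only exponent that contributes.\<close>
  define \<delta> where "\<delta> j = (if j = i then \<alpha> i else 0)" for j
  have "\<beta> j \<le> Max (\<alpha> ` {j. \<alpha> j \<noteq> 0})" if "\<beta> \<in> ?B" "\<alpha> j \<noteq> 0" for \<beta> j
  proof -
    have "\<alpha> j \<le> Max (\<alpha> ` {j. \<alpha> j \<noteq> 0})" using that(2) fin by (intro Max_ge) auto
    then show ?thesis using that(1) le_trans by blast
  qed
  moreover have "\<beta> j = 0" if "\<beta> \<in> ?B" "\<alpha> j = 0" for \<beta> j
    using that by (metis le_zero_eq mem_Collect_eq)
  ultimately have "?B \<subseteq> {\<beta>. \<forall>j. (j \<in> {j. \<alpha> j \<noteq> 0} \<longrightarrow> \<beta> j \<in> {..Max (\<alpha> ` {j. \<alpha> j \<noteq> 0})}) \<and>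
      (j \<notin> {j. \<alpha> j \<noteq> 0} \<longrightarrow> \<beta> j = 0)}" by blast
  then have finB: "finite ?B"
    by (rule finite_subset) (intro finite_set_of_finite_funs fin finite_atMost)
  have zero: "memb i F \<beta> * G (\<lambda>j. \<alpha> j - \<beta> j) = 0" if "\<beta> \<in> ?B" "\<beta> \<noteq> \<delta>" for \<beta>
  proof (cases "\<forall>j. j \<noteq> i \<longrightarrow> \<beta> j = 0")
    case True
    then have "\<beta> i \<noteq> \<alpha> i" using that(2) unfolding \<delta>_def fun_eq_iff by metis
    moreover have "\<beta> i \<le> \<alpha> i" using that(1) by simp
    ultimately show ?thesis by (subst G) auto
  next
    case False
    then have "memb i F \<beta> = 0" unfolding memb_def by (rule if_not_P)
    then show ?thesis by simp
  qed
  have "mmult (memb i F) G \<alpha> = (\<Sum>\<beta> \<in> {\<delta>}. memb i F \<beta> * G (\<lambda>j. \<alpha> j - \<beta> j))"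
    unfolding mmult_def by (intro sum.mono_neutral_right finB) (use zero in \<open>auto simp: \<delta>_def\<close>)
  moreover have "(\<lambda>j. \<alpha> j - \<delta> j) = \<alpha>(i := 0)" by (auto simp: \<delta>_def)
  moreover have "memb i F \<delta> = F $ \<alpha> i" by (simp add: memb_def \<delta>_def)
  ultimately show ?thesis by simp
qed

text \<open>The variables are distinct, so the product has only one way to reach a given
  exponent.\<close>

lemma mprod_list_memb:
  assumes "distinct js" "finite {j. \<alpha> j \<noteq> 0}"
  shows "mprod_list (map (\<lambda>j. memb j (F j)) js) \<alpha>
    = (if \<forall>j. j \<notin> set js \<longrightarrow> \<alpha> j = 0 then \<Prod>j \<in> set js. F j $ \<alpha> j else 0)"
  using assms
proof (induction js arbitrary: \<alpha>)
  case Nil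
  then show ?case by (simp add: mprod_list_def mone_def)
next
  case (Cons i js)
  let ?G = "mprod_list (map (\<lambda>j. memb j (F j)) js)"
  have fin: "finite {j. \<gamma> j \<noteq> 0}" if "\<forall>j. \<gamma> j \<le> \<alpha> j" for \<gamma> :: "nat \<Rightarrow> nat"
    by (rule finite_subset[OF _ Cons.prems(2)]) (use that in \<open>force simp: less_le_trans\<close>)
  have i: "i \<notin> set js" "distinct js" using Cons.prems by auto
  have "?G \<gamma> = 0" if "\<forall>j. \<gamma> j \<le> \<alpha> j" "\<gamma> i \<noteq> 0" for \<gamma>
    using Cons.IH[OF i(2) fin[OF that(1)]] that(2) i(1) by auto
  then have "mprod_list (map (\<lambda>j. memb j (F j)) (i # js)) \<alpha> = F i $ \<alpha> i * ?G (\<alpha>(i := 0))"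
    using mmult_memb[OF Cons.prems(2), of i ?G "F i"] by (simp add: mprod_list_def)
  also have "?G (\<alpha>(i := 0)) = (if \<forall>j. j \<notin> set js \<longrightarrow> (\<alpha>(i := 0)) j = 0
      then \<Prod>j \<in> set js. F j $ (\<alpha>(i := 0)) j else 0)"
    by (rule Cons.IH[OF i(2) fin]) simp
  also have "(\<Prod>j \<in> set js. F j $ (\<alpha>(i := 0)) j) = (\<Prod>j \<in> set js. F j $ \<alpha> j)"
    using i(1) by (intro prod.cong) auto
  finally show ?case using i(1) by auto
qed

text \<open>This brings the coefficient into the form of \<open>card_cyc_words\<close>.\<close>

lemma rhsA_eq:
  assumes \<alpha>: "\<forall>j. \<alpha> j \<noteq> 0 \<longrightarrow> j \<in> {1..k}"
  shows "rhsA n m k \<alpha> = (\<Prod>j \<in> {1..k}. (1 :: real fps) $ \<alpha> j)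
    + (\<Sum>i = 1..k. Lap (TD n m $ \<alpha> i *
        ((\<Prod>j \<in> {1..k} - {i}. TH n m $ \<alpha> j) - (\<Prod>j \<in> {1..k} - {i}. 1 $ \<alpha> j))))
    + (\<Sum>i = 1..k. geomser n m $ \<alpha> i * (\<Prod>j \<in> {1..k} - {i}. 1 $ \<alpha> j))"
proof -
  have fin: "finite {j. \<alpha> j \<noteq> 0}" by (rule finite_subset[of _ "{1..k}"]) (use \<alpha> in auto)
  have 1: "mone \<alpha> = (\<Prod>j \<in> {1..k}. (1 :: real fps) $ \<alpha> j)"
    using \<alpha> by (auto simp: prod_fps_one_nth mone_def)
  have iff: "(\<forall>j. j \<noteq> i \<longrightarrow> \<alpha> j = 0) \<longleftrightarrow> (\<forall>j \<in> {1..k} - {i}. \<alpha> j = 0)" for i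
    using \<alpha> by blast
  have 2: "memb i (geomser n m) \<alpha> = geomser n m $ \<alpha> i * (\<Prod>j \<in> {1..k} - {i}. 1 $ \<alpha> j)" for i
    unfolding memb_def iff by (subst prod_fps_one_nth) auto
  have 3: "mmult (memb i (TD n m)) (mminus (mprod_list (map (\<lambda>j. memb j (TH n m)) (filter (\<lambda>j. j \<noteq> i) [1..<k+1]))) mone) \<alpha>
     = TD n m $ \<alpha> i * ((\<Prod>j \<in> {1..k} - {i}. TH n m $ \<alpha> j) - (\<Prod>j \<in> {1..k} - {i}. 1 $ \<alpha> j))"
    (is "mmult _ (mminus ?G mone) \<alpha> = _") if i: "i \<in> {1..k}" for i
  proof -
    have set: "set (filter (\<lambda>j. j \<noteq> i) [1..<k+1]) = {1..k} - {i}" by auto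
    have G: "?G \<gamma> = (if \<forall>j. j \<notin> {1..k} - {i} \<longrightarrow> \<gamma> j = 0 then \<Prod>j \<in> {1..k} - {i}. TH n m $ \<gamma> j else 0)"
      if "\<forall>j. \<gamma> j \<le> \<alpha> j" for \<gamma>
    proof -
      have "finite {j. \<gamma> j \<noteq> 0}"
        by (rule finite_subset[OF _ fin]) (use that in \<open>force simp: less_le_trans\<close>)
      then show ?thesis
        using mprod_list_memb[of "filter (\<lambda>j. j \<noteq> i) [1..<k+1]" \<gamma> "\<lambda>_. TH n m"] unfolding set by simp
    qed
    \<comment> \<open>Neither the product over the other letters nor the series 1 involves the
      variable of \<open>i\<close>.\<close>
    have "mmult (memb i (TD n m)) (mminus ?G mone) \<alpha> = TD n m $ \<alpha> i * mminus ?G mone (\<alpha>(i := 0))"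
    proof (rule mmult_memb[OF fin])
      fix \<gamma> :: "nat \<Rightarrow> nat" assume "\<forall>j. \<gamma> j \<le> \<alpha> j" "\<gamma> i \<noteq> 0"
      then show "mminus ?G mone \<gamma> = 0" using G[of \<gamma>] by (auto simp: mminus_def mone_def)
    qed
    also have "mminus ?G mone (\<alpha>(i := 0)) = (\<Prod>j \<in> {1..k} - {i}. TH n m $ \<alpha> j) - (\<Prod>j \<in> {1..k} - {i}. 1 $ \<alpha> j)"
    proof -
      have le: "\<forall>j. (\<alpha>(i := 0)) j \<le> \<alpha> j" by simp
      have z: "\<forall>j. j \<notin> {1..k} - {i} \<longrightarrow> (\<alpha>(i := 0)) j = 0" using \<alpha> by (metis DiffI fun_upd_apply singletonD)
      have "?G (\<alpha>(i := 0)) = (\<Prod>j \<in> {1..k} - {i}. TH n m $ (\<alpha>(i := 0)) j)"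
        unfolding G[OF le] by (rule if_P[OF z])
      also have "\<dots> = (\<Prod>j \<in> {1..k} - {i}. TH n m $ \<alpha> j)" by (intro prod.cong) auto
      moreover have "mone (\<alpha>(i := 0)) = (\<Prod>j \<in> {1..k} - {i}. (1 :: real poly fps) $ \<alpha> j)"
        by (subst prod_fps_one_nth) (simp_all only: finite_Diff finite_atLeastAtMost mone_def fun_upd_apply flip: iff, auto)
      ultimately show ?thesis by (simp only: mminus_def)
    qed
    finally show ?thesis .
  qed
  show ?thesis
    unfolding rhsA_def Lap_def 1 2 by (simp only: 3 cong: sum.cong)
qed

text \<open>Multisets of size \<open>l\<close> over \<open>K\<close> are the exponent vectors of
  total degree \<open>l\<close>; summing over them sets all variables equal.\<close>

lemma sum_multisets_prod_remove:
  fixes A B :: "'a::comm_ring_1 fps"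
  assumes "finite K" "i \<in> K"
  shows "(\<Sum>X \<in> multisets_of_size K l. A $ count X i * (\<Prod>j \<in> K - {i}. B $ count X j)) = (A * B ^ (card K - 1)) $ l"
proof -
  define F where "F j = (if j = i then A else B)" for j
  have "(\<Prod>j \<in> K. F j $ count X j) = A $ count X i * (\<Prod>j \<in> K - {i}. B $ count X j)" for X
  proof -
    have "(\<Prod>j \<in> K - {i}. F j $ count X j) = (\<Prod>j \<in> K - {i}. B $ count X j)"
      by (intro prod.cong) (auto simp: F_def)
    then show ?thesis using assms by (simp add: prod.remove F_def)
  qed
  moreover have "(\<Prod>j \<in> K. F j) = A * B ^ (card K - 1)"
  proof -
    have "(\<Prod>j \<in> K - {i}. F j) = (\<Prod>j \<in> K - {i}. B)" by (intro prod.cong) (auto simp: F_def)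
    then show ?thesis using assms by (simp add: prod.remove F_def)
  qed
  ultimately show ?thesis using fps_prod_nth'[OF assms(1), of F l] by simp
qed

theorem theorem5p2:
  fixes m n k :: nat
  assumes "0 < m" and "0 < n" and "0 < k"
  shows "(\<forall>\<alpha> :: nat \<Rightarrow> nat. (\<forall>j. \<alpha> j \<noteq> 0 \<longrightarrow> j \<in> {1..k}) \<longrightarrow>
            genA n m k \<alpha> = rhsA n m k \<alpha>)
       \<and> (\<forall>l. real (card {W \<in> cycA n m k. length W = l}) =
            (if l = 0 then 1 else 0)
            + real k * Phi (tinv (fps_nth (TD n m * (TH n m ^ (k - 1) - 1)) l))
            + real k * fps_nth (geomser n m) l)"
proof (intro conjI allI impI)
  fix \<alpha> :: "nat \<Rightarrow> nat" assume \<alpha>: "\<forall>j. \<alpha> j \<noteq> 0 \<longrightarrow> j \<in> {1..k}"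
  \<comment> \<open>Letters outside the alphabet satisfy the count condition automatically.\<close>
  have "count_list W j = \<alpha> j" if "set W \<subseteq> {1..k}" "j \<notin> {1..k}" for W j
    using that \<alpha> by (metis count_list_0_iff subsetD)
  then have "{W \<in> cycA n m k. \<forall>j. count_list W j = \<alpha> j} = cyc_words n m {1..k} \<alpha>"
    unfolding cycA_def cyc_words_def by blast
  then show "genA n m k \<alpha> = rhsA n m k \<alpha>"
    unfolding genA_def rhsA_eq[OF \<alpha>] using card_cyc_words[OF assms(1,2), of "{1..k}" \<alpha>] by simp
next
  fix l
  let ?K = "{1..k}" and ?M = "multisets_of_size {1..k} l"
  let ?one = "1 :: real poly fps"
  \<comment> \<open>Words of length \<open>l\<close> are sorted by their multiset of letters, which
    reduces the second claim to \<open>card_cyc_words\<close>.\<close>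
  have "{W \<in> cycA n m k. length W = l} = (\<Union>X \<in> ?M. cyc_words n m ?K (count X))"
  proof (intro equalityI subsetI)
    fix W assume "W \<in> {W \<in> cycA n m k. length W = l}"
    then show "W \<in> (\<Union>X \<in> ?M. cyc_words n m ?K (count X))"
      by (intro UN_I[of "mset W"]) (auto simp: cycA_def cyc_words_def multisets_of_size_def count_mset)
  next
    fix W assume "W \<in> (\<Union>X \<in> ?M. cyc_words n m ?K (count X))"
    then obtain X where X: "set_mset X \<subseteq> ?K" "size X = l" "W \<in> cyc_words n m ?K (count X)"
      by (auto simp: multisets_of_size_def)
    then have "length W = (\<Sum>j \<in> ?K. count X j)"
      using sum_count_set[of W ?K] by (simp add: cyc_words_def)
    also have "\<dots> = l"
      using X(1,2) sum.mono_neutral_left[of ?K "set_mset X" "count X"]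
      by (simp add: size_multiset_overloaded_eq not_in_iff)
    finally show "W \<in> {W \<in> cycA n m k. length W = l}"
      using X(3) by (simp add: cyc_words_def cycA_def)
  qed
  also have "card \<dots> = (\<Sum>X \<in> ?M. card (cyc_words n m ?K (count X)))"
  proof (rule card_UN_disjoint)
    have "X = Y" if "X \<in> ?M" "Y \<in> ?M" "W \<in> cyc_words n m ?K (count X)" "W \<in> cyc_words n m ?K (count Y)" for X Y W
    proof (rule multiset_eqI)
      fix j show "count X j = count Y j"
      proof (cases "j \<in> ?K")
        case True
        then have "count_list W j = count X j" "count_list W j = count Y j"
          using that(3,4) unfolding cyc_words_def by blast+
        then show ?thesis by simp
      next
        case False
        then have "j \<notin># X" "j \<notin># Y" using that(1,2) unfolding multisets_of_size_def by blast+
        then show ?thesis by (simp add: not_in_iff)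
      qed
    qed
    then show "\<forall>X \<in> ?M. \<forall>Y \<in> ?M. X \<noteq> Y \<longrightarrow> cyc_words n m ?K (count X) \<inter> cyc_words n m ?K (count Y) = {}"
      by blast
  qed (simp_all add: finite_cyc_words finite_multisets_of_size)
  finally have "real (card {W \<in> cycA n m k. length W = l})
     = (\<Sum>X \<in> ?M. real (card (cyc_words n m ?K (count X))))" by simp
  also have "\<dots> = (\<Sum>X \<in> ?M. \<Prod>j \<in> ?K. (1 :: real fps) $ count X j)
    + (\<Sum>X \<in> ?M. \<Sum>i \<in> ?K. Lap (TD n m $ count X i *
        ((\<Prod>j \<in> ?K - {i}. TH n m $ count X j) - (\<Prod>j \<in> ?K - {i}. ?one $ count X j))))
    + (\<Sum>X \<in> ?M. \<Sum>i \<in> ?K. geomser n m $ count X i * (\<Prod>j \<in> ?K - {i}. 1 $ count X j))"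
    using card_cyc_words[OF assms(1,2), of ?K] by (simp add: sum.distrib)
  also have "(\<Sum>X \<in> ?M. \<Prod>j \<in> ?K. (1 :: real fps) $ count X j) = (if l = 0 then 1 else 0)"
    using fps_prod_nth'[of ?K "\<lambda>_. 1 :: real fps" l] by simp
  also have "(\<Sum>X \<in> ?M. \<Sum>i \<in> ?K. geomser n m $ count X i * (\<Prod>j \<in> ?K - {i}. 1 $ count X j))
     = (\<Sum>i \<in> ?K. geomser n m $ l)"
    by (subst sum.swap, intro sum.cong refl) (simp add: sum_multisets_prod_remove del: fps_one_nth)
  also have "(\<Sum>X \<in> ?M. \<Sum>i \<in> ?K. Lap (TD n m $ count X i *
        ((\<Prod>j \<in> ?K - {i}. TH n m $ count X j) - (\<Prod>j \<in> ?K - {i}. ?one $ count X j))))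
     = (\<Sum>i \<in> ?K. Lap ((TD n m * (TH n m ^ (k - 1) - 1)) $ l))"
  proof (subst sum.swap, intro sum.cong refl)
    fix i assume i: "i \<in> ?K"
    \<comment> \<open>The subtracted product of ones is the case \<open>B = 1\<close> of the same
      summation.\<close>
    have "(\<Sum>X \<in> ?M. TD n m $ count X i *
        ((\<Prod>j \<in> ?K - {i}. TH n m $ count X j) - (\<Prod>j \<in> ?K - {i}. ?one $ count X j)))
      = (TD n m * TH n m ^ (k - 1)) $ l - (TD n m * 1 ^ (k - 1)) $ l"
      using sum_multisets_prod_remove[of ?K i "TD n m" "TH n m" l]
        sum_multisets_prod_remove[of ?K i "TD n m" 1 l] i
      by (simp add: right_diff_distrib sum_subtractf del: fps_one_nth)
    then show "(\<Sum>X \<in> ?M. Lap (TD n m $ count X i *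
        ((\<Prod>j \<in> ?K - {i}. TH n m $ count X j) - (\<Prod>j \<in> ?K - {i}. ?one $ count X j))))
      = Lap ((TD n m * (TH n m ^ (k - 1) - 1)) $ l)"
      by (simp add: right_diff_distrib flip: Lap_sum)
  qed
  finally show "real (card {W \<in> cycA n m k. length W = l}) = (if l = 0 then 1 else 0)
      + real k * Phi (tinv (fps_nth (TD n m * (TH n m ^ (k - 1) - 1)) l))
      + real k * fps_nth (geomser n m) l"
    by (simp add: Lap_def)
qed

end
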